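(* Let $N=2$, $M\ge1$, let $\Omega\subset\mathbf{R}^2$ be open and let $K$ be an $M$-quasiminimal set in $\Omega$. Then the points of $K\setminus K^*$ are isolated in $\Omega$, where $K^*$ is the set of interface points of $K$.
   Context: $B(x,r)$ denotes the open ball of center $x$ and radius $r$; $\mathcal{H}^{N-1}$ is the $(N-1)$-dimensional Hausdorff measure (here $N=2$); $A\subset\subset\Omega$ means $\overline{A}\subset\Omega$. Let $\Omega\subset\mathbf{R}^N$ be open. A coral set $K\subset\Omega$ is a relatively closed subset of $\Omega$ such that $\mathcal{H}^{N-1}(K\cap B(x,r))>0$ for all $x\in K$ and all $r>0$. A topological competitor of $K$ in a ball $B(x_0,r)\subset\subset\Omega$ is a relatively closed subset $F\subset\Omega$ such that $F\setminus B(x_0,r)=K\setminus B(x_0,r)$ and such that for all $x,y\in\Omega\setminus(B(x_0,r)\cup K)$, if $x,y$ lie in distinct connected components of $\Omega\setminus K$, then they lie in distinct connected components of $\Omega\setminus F$. For $M\ge1$, an $M$-quasiminimal set in $\Omega$ is a coral set $K\subset\Omega$ which is $\mathcal{H}^{N-1}$-locally finite in $\Omega$ and such that for all $x_0\in K$, all $r>0$ with $B(x_0,r)\subset\subset\Omega$ and all topological competitors $F$ of $K$ in $B(x_0,r)$, one has $\mathcal{H}^{N-1}(K\setminus F)\le M\,\mathcal{H}^{N-1}(F\setminus K)$. The set $K^*$ of interface points of $K$ is the set of points $x_0\in K$ for which there exists $r>0$ such that $B(x_0,r)\subset\Omega$ and $B(x_0,r)\setminus K$ meets exactly two connected components of $\Omega\setminus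 K$. It is a relatively open subset of $K$, so $K\setminus K^*$ is relatively closed in $\Omega$. *)

theory Defs
  imports "HOL-Analysis.Analysis"
begin

text \<open>
  The Hausdorff measure of integer dimension \<open>d\<close>, as an outer measure on all subsets, with the
  normalisation \<open>\<omega>\<^sub>d / 2\<^sup>d\<close> (\<open>\<omega>\<^sub>d\<close> the volume of the unit ball of dimension \<open>d\<close>; the constant
  is 1 for \<open>d = 1\<close>). The covering sets are required to be bounded because \<^const>\<open>diameter\<close>
  is not meaningful on unbounded sets, and the empty set is assigned weight 0 separately because
  \<open>0 ^ 0 = 1\<close>.
\<close>

definition hausdorff_weight :: "nat \<Rightarrow> 'a::metric_space set \<Rightarrow> real" where
  "hausdorff_weight d C =
     (if C = {} then 0 else unit_ball_vol (real d) / 2 ^ d * diameter C ^ d)"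

definition hausdorff_covers :: "real \<Rightarrow> 'a::metric_space set \<Rightarrow> (nat \<Rightarrow> 'a set) set" where
  "hausdorff_covers \<delta> A =
     {C. A \<subseteq> (\<Union>i. C i) \<and> (\<forall>i. bounded (C i) \<and> diameter (C i) \<le> \<delta>)}"

definition hausdorff_pre :: "nat \<Rightarrow> real \<Rightarrow> 'a::metric_space set \<Rightarrow> ennreal" where
  "hausdorff_pre d \<delta> A =
     (INF C\<in>hausdorff_covers \<delta> A. \<Sum>i. ennreal (hausdorff_weight d (C i)))"

text \<open>
  The premeasures increase as \<open>\<delta>\<close> decreases to 0, so the limit is a supremum.
\<close>

definition hausdorff_measure :: "nat \<Rightarrow> 'a::metric_space set \<Rightarrow> ennreal" where
  "hausdorff_measure d A = (SUP \<delta>\<in>{0<..}. hausdorff_pre d \<delta> A)"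

text \<open>In a space of dimension \<open>N\<close>: the measure of dimension \<open>N - 1\<close>.\<close>

definition hausdorff_codim1 :: "'a::euclidean_space set \<Rightarrow> ennreal" where
  "hausdorff_codim1 A = hausdorff_measure (DIM('a) - 1) A"

definition coral_set :: "'a::euclidean_space set \<Rightarrow> 'a set \<Rightarrow> bool" where
  "coral_set \<Omega> K \<longleftrightarrow>
     closedin (top_of_set \<Omega>) K \<and>
     (\<forall>x\<in>K. \<forall>r>0. hausdorff_codim1 (K \<inter> ball x r) > 0)"

definition hausdorff_locally_finite :: "'a::euclidean_space set \<Rightarrow> 'a set \<Rightarrow> bool" where
  "hausdorff_locally_finite \<Omega> K \<longleftrightarrow>
     (\<forall>x\<in>\<Omega>. \<exists>r>0. hausdorff_codim1 (K \<inter> ball x r) < \<infinity>)"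

definition topological_competitor ::
    "'a::euclidean_space set \<Rightarrow> 'a set \<Rightarrow> 'a \<Rightarrow> real \<Rightarrow> 'a set \<Rightarrow> bool" where
  "topological_competitor \<Omega> K x0 r F \<longleftrightarrow>
     closedin (top_of_set \<Omega>) F \<and>
     F - ball x0 r = K - ball x0 r \<and>
     (\<forall>x \<in> \<Omega> - (ball x0 r \<union> K). \<forall>y \<in> \<Omega> - (ball x0 r \<union> K).
        connected_component_set (\<Omega> - K) x \<noteq> connected_component_set (\<Omega> - K) y \<longrightarrow>
        connected_component_set (\<Omega> - F) x \<noteq> connected_component_set (\<Omega> - F) y)"

definition quasiminimal_set :: "real \<Rightarrow> 'a::euclidean_space set \<Rightarrow> 'a set \<Rightarrow> bool" where
  "quasiminimal_set M \<Omega> K \<longleftrightarrow>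
     coral_set \<Omega> K \<and>
     hausdorff_locally_finite \<Omega> K \<and>
     (\<forall>x0\<in>K. \<forall>r>0. closure (ball x0 r) \<subseteq> \<Omega> \<longrightarrow>
        (\<forall>F. topological_competitor \<Omega> K x0 r F \<longrightarrow>
           hausdorff_codim1 (K - F) \<le> ennreal M * hausdorff_codim1 (F - K)))"

definition interface_points :: "'a::euclidean_space set \<Rightarrow> 'a set \<Rightarrow> 'a set" where
  "interface_points \<Omega> K =
     {x0\<in>K. \<exists>r>0. ball x0 r \<subseteq> \<Omega> \<and>
        card {C \<in> components (\<Omega> - K). C \<inter> (ball x0 r - K) \<noteq> {}} = 2}"

end

theory Submission
  imports Defs
begin

text \<open>
  Let \<open>K\<close> be quasiminimal. If a topological competitor \<open>F\<close> of \<open>K\<close> is contained in \<open>K\<close>, then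
  \<open>F - K\<close> is empty, so \<open>K - F\<close> has measure zero, and since \<open>K\<close> is coral this forces \<open>F = K\<close>:
  no part of \<open>K\<close> can be erased inside a disc without joining two components that reach outside
  the disc. Moreover \<open>K\<close> has locally finite length, so almost every small circle meets \<open>K\<close> in
  finitely many points. The whole proof uses only these two topological properties, which are
  collected in the locale \<open>irreducible_separator\<close>. The rest is plane topology; it rests on
  Janiszewski's theorem and the Jordan curve theorem, is carried out in the complex plane and is
  transported to \<open>real ^ 2\<close> by an isometry.

  Fix a disc centred on \<open>K\<close> whose boundary circle meets \<open>K\<close> in a finite set \<open>P\<close>, and let \<open>L\<close> be
  the part of \<open>K\<close> in the closed disc. For a point \<open>x\<close> of \<open>L\<close> off the circle, a piece of \<open>L - {x}\<close> that
  avoids \<open>P\<close> would touch the rest of \<open>K\<close> at \<open>x\<close> only, so by Janiszewski's theorem it could be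
  erased. Hence every nonempty clopen part of \<open>L - {x}\<close> meets \<open>P\<close>, and \<open>L - {x}\<close> has finitely many
  components, each reaching \<open>P\<close> (\<open>clopen_meets_circle\<close>). Call \<open>x\<close> a branch point if at least three
  of these components have \<open>x\<close> in their closure. The way in which \<open>x\<close> partitions \<open>P\<close> determines a
  branch point \<open>x\<close>, so there are only finitely many of them (\<open>finite_branch_points\<close>).

  Conversely, let three components \<open>D1\<close>, \<open>D2\<close>, \<open>D3\<close> of the complement touch \<open>x\<close> and reach a larger
  circle. Finiteness of \<open>K\<close> on small circles makes \<open>x\<close> accessible by an arc inside each of the
  three components. The three arcs cut the disc into three sectors. Were \<open>K\<close> absent near \<open>x\<close> from
  the sector between \<open>D1\<close> and \<open>D2\<close>, Janiszewski's theorem would connect \<open>D1\<close> to \<open>D2\<close>; so every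
  sector contains a component of \<open>L - {x}\<close> that touches \<open>x\<close>, and \<open>x\<close> is a branch point
  (\<open>branch_point_if_three_components\<close>).

  It remains to see that three components touch every point that is not an interface point. Only
  finitely many components cross a circle that meets \<open>K\<close> finitely often. Deleting from \<open>K\<close>, inside
  the disc, whatever is not in the closure of a crossing component other than a prescribed one
  gives a competitor, so every point of \<open>K\<close> in the disc touches at least two crossing components.
  Thus a component \<open>D\<close> lying inside the disc would have only points with three touching components
  on its boundary; these being locally finite, \<open>D\<close> would fill a punctured neighbourhood of a
  boundary point, leaving no room for the crossing components
  (\<open>no_component_inside_disc\<close>). So all components that meet the disc cross its boundary, and if
  \<open>x\<close> is not an interface point then the number of those touching \<open>x\<close> is at least two and
  different from two, so \<open>x\<close> is a branch point.
\<close>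

section \<open>Slicing sets of finite length by circles\<close>

lemma hausdorff_measure_mono:
  assumes "A \<subseteq> B"
  shows "hausdorff_measure d A \<le> hausdorff_measure d B"
proof -
  have "hausdorff_covers \<delta> B \<subseteq> hausdorff_covers \<delta> A" for \<delta>
    using assms unfolding hausdorff_covers_def by blast
  then have "hausdorff_pre d \<delta> A \<le> hausdorff_pre d \<delta> B" for \<delta>
    unfolding hausdorff_pre_def by (rule INF_superset_mono) auto
  then show ?thesis
    unfolding hausdorff_measure_def by (intro SUP_mono') auto
qed

lemma hausdorff_measure_empty: "hausdorff_measure d {} = 0"
proof -
  have "hausdorff_pre d \<delta> ({} :: 'a set) = 0" if "\<delta> > 0" for \<delta>
  proof -
    have "(\<lambda>_. {}) \<in> hausdorff_covers \<delta> ({} :: 'a set)"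
      using that by (simp add: hausdorff_covers_def diameter_def)
    then have "hausdorff_pre d \<delta> ({} :: 'a set)
        \<le> (\<Sum>i::nat. ennreal (hausdorff_weight d ({} :: 'a set)))"
      unfolding hausdorff_pre_def by (rule INF_lower)
    also have "\<dots> = 0" by (simp add: hausdorff_weight_def)
    finally show ?thesis by simp
  qed
  then show ?thesis
    unfolding hausdorff_measure_def by (intro antisym SUP_least) auto
qed

text \<open>
  Take covers of bounded total length by sets of smaller and smaller diameter, and count the
  covering sets that may meet a given slice. If the slice has \<open>m\<close> points, then the count is at least
  \<open>m\<close> once the diameters are small; and by Fatou's lemma the limit inferior of the counts is
  integrable over the radius, so it is finite for almost every radius.
\<close>

lemma exists_finite_sphere_slice:
  fixes A :: "'a::metric_space set"
  assumes fin: "hausdorff_measure 1 A < \<infinity>" and "0 < \<rho>"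
  obtains t where "0 < t" "t < \<rho>" "finite (A \<inter> sphere x t)"
proof -
  obtain h where h: "hausdorff_measure 1 A = ennreal h" "h \<ge> 0"
    using fin by (cases "hausdorff_measure 1 A") auto
  have "\<exists>C. C \<in> hausdorff_covers (1 / Suc k) A
      \<and> (\<Sum>i. ennreal (hausdorff_weight 1 (C i))) < ennreal (h + 1)" for k
  proof -
    have "hausdorff_pre 1 (1 / Suc k) A \<le> hausdorff_measure 1 A"
      unfolding hausdorff_measure_def by (rule SUP_upper) auto
    also have "\<dots> < ennreal (h + 1)"
      using h by (simp add: ennreal_lessI)
    finally show ?thesis
      unfolding hausdorff_pre_def by (auto simp: INF_less_iff)
  qed
  then obtain C where
    C: "\<And>k. C k \<in> hausdorff_covers (1 / Suc k) A" and
    sumC: "\<And>k. (\<Sum>i. ennreal (hausdorff_weight 1 (C k i))) < ennreal (h + 1)"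
    by metis
  have C_cover: "\<And>k. A \<subseteq> (\<Union>i. C k i)" and C_bdd: "\<And>k i. bounded (C k i)"
    and C_diam: "\<And>k i. diameter (C k i) \<le> 1 / Suc k"
    using C unfolding hausdorff_covers_def by auto
  \<comment> \<open>The distances from \<open>x\<close> to a covering set lie in an interval of twice its diameter.\<close>
  define c where "c k i = (SOME a. a \<in> C k i)" for k i
  have c: "c k i \<in> C k i" if "C k i \<noteq> {}" for k i
    using that unfolding c_def by (simp add: some_in_eq)
  define I where "I k i = (if C k i = {} then {} else
      {dist x (c k i) - diameter (C k i) .. dist x (c k i) + diameter (C k i)})" for k i
  have diam_nonneg: "diameter (C k i) \<ge> 0" for k i
    using C_bdd by (rule diameter_ge_0)
  have emI: "emeasure lborel (I k i) = 2 * ennreal (hausdorff_weight 1 (C k i))" for k i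
  proof (cases "C k i = {}")
    case False
    have "emeasure lborel (I k i) = ennreal (2 * diameter (C k i))"
      using False diam_nonneg[of k i] by (simp add: I_def)
    also have "\<dots> = ennreal 2 * ennreal (diameter (C k i))"
      using diam_nonneg by (rule ennreal_mult'')
    finally show ?thesis using False by (simp add: hausdorff_weight_def)
  qed (simp add: I_def hausdorff_weight_def)
  have inI: "dist x a \<in> I k i" if "a \<in> C k i" for a k i
  proof -
    have ne: "C k i \<noteq> {}" using that by auto
    have "dist a (c k i) \<le> diameter (C k i)"
      using C_bdd that c[OF ne] by (rule diameter_bounded_bound)
    moreover have "\<bar>dist x a - dist x (c k i)\<bar> \<le> dist a (c k i)"
      by (metis abs_dist_diff_le dist_commute)
    ultimately show ?thesis using ne by (auto simp: I_def)
  qed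
  define N where "N k t = (\<Sum>i. indicator (I k i) t :: ennreal)" for k and t :: real
  have I_meas [measurable]: "I k i \<in> sets lborel" for k i
    by (simp add: I_def)
  have N_meas [measurable]: "N k \<in> borel_measurable lborel" for k
    unfolding N_def by measurable
  have int_N: "(\<integral>\<^sup>+t. N k t \<partial>lborel) \<le> ennreal (2 * (h + 1))" for k
  proof -
    have "(\<integral>\<^sup>+t. N k t \<partial>lborel) = (\<Sum>i. \<integral>\<^sup>+t. indicator (I k i) t \<partial>lborel)"
      unfolding N_def by (rule nn_integral_suminf) measurable
    also have "\<dots> = (\<Sum>i. 2 * ennreal (hausdorff_weight 1 (C k i)))"
      by (simp only: nn_integral_indicator[OF I_meas] emI)
    also have "\<dots> = 2 * (\<Sum>i. ennreal (hausdorff_weight 1 (C k i)))"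
      by (rule ennreal_suminf_cmult)
    also have "\<dots> \<le> 2 * ennreal (h + 1)"
      using sumC[of k] by (intro mult_left_mono) auto
    also have "\<dots> = ennreal (2 * (h + 1))"
      by (metis add_nonneg_nonneg ennreal_mult'' ennreal_numeral h(2) zero_le_one)
    finally show ?thesis .
  qed
  have "(\<integral>\<^sup>+t. liminf (\<lambda>k. N k t) \<partial>lborel) \<le> liminf (\<lambda>k. \<integral>\<^sup>+t. N k t \<partial>lborel)"
    by (rule nn_integral_liminf) measurable
  also have "\<dots> \<le> liminf (\<lambda>k::nat. ennreal (2 * (h + 1)))"
    by (rule Liminf_mono) (use int_N in auto)
  also have "\<dots> = ennreal (2 * (h + 1))" by (simp add: Liminf_const)
  finally have "(\<integral>\<^sup>+t. liminf (\<lambda>k. N k t) \<partial>lborel) \<noteq> \<infinity>"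
    by (auto simp: top_unique)
  then have "AE t in lborel. liminf (\<lambda>k. N k t) \<noteq> \<infinity>"
    by (intro nn_integral_PInf_AE) measurable
  then obtain Z where Z: "{t \<in> space lborel. \<not> liminf (\<lambda>k. N k t) \<noteq> \<infinity>} \<subseteq> Z"
      "emeasure lborel Z = 0" "Z \<in> sets lborel"
    by (rule AE_E)
  have "\<not> {0<..<\<rho>} \<subseteq> Z"
  proof
    assume "{0<..<\<rho>} \<subseteq> Z"
    then have "emeasure lborel {0<..<\<rho>} \<le> emeasure lborel Z"
      using Z(3) by (rule emeasure_mono)
    then show False using Z(2) \<open>0 < \<rho>\<close> by simp
  qed
  then obtain t where "t \<in> {0<..<\<rho>}" "t \<notin> Z" by blast
  then have t: "0 < t" "t < \<rho>" "t \<notin> Z" by auto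
  then have liminf_fin: "liminf (\<lambda>k. N k t) \<noteq> \<infinity>" using Z(1) by auto
  have "finite (A \<inter> sphere x t)"
  proof (rule ccontr)
    assume inf: "infinite (A \<inter> sphere x t)"
    have "of_nat m \<le> liminf (\<lambda>k. N k t)" for m
    proof -
      obtain T where T: "T \<subseteq> A \<inter> sphere x t" "finite T" "card T = m"
        using inf infinite_arbitrarily_large by metis
      define e where "e = Min (insert 1 ((\<lambda>(a,b). dist a b) ` {p \<in> T \<times> T. fst p \<noteq> snd p}))"
      have fin_e: "finite (insert 1 ((\<lambda>(a,b). dist a b) ` {p \<in> T \<times> T. fst p \<noteq> snd p}))"
        using T(2) by auto
      have "e > 0" unfolding e_def using fin_e by (subst Min_gr_iff) auto
      have e: "e \<le> dist a b" if "a \<in> T" "b \<in> T" "a \<noteq> b" for a b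
        unfolding e_def by (rule Min_le[OF fin_e]) (use that in force)
      have "\<forall>\<^sub>F k in sequentially. 1 / Suc k < e"
        using \<open>e > 0\<close> LIMSEQ_Suc[OF lim_1_over_n]
        by (auto dest!: order_tendstoD(2) simp: field_simps)
      then have "\<forall>\<^sub>F k in sequentially. of_nat m \<le> N k t"
      proof (rule eventually_mono)
        fix k assume k: "1 / real (Suc k) < e"
        have "\<forall>a\<in>T. \<exists>i. a \<in> C k i" using T(1) C_cover by blast
        then obtain idx where idx: "\<And>a. a \<in> T \<Longrightarrow> a \<in> C k (idx a)" by metis
        have "inj_on idx T"
        proof (rule inj_onI, rule ccontr)
          fix a b assume ab: "a \<in> T" "b \<in> T" "idx a = idx b" "a \<noteq> b"
          have "dist a b \<le> diameter (C k (idx a))"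
            using C_bdd idx ab by (metis diameter_bounded_bound)
          then show False using C_diam[of k "idx a"] k e[OF ab(1,2,4)] by linarith
        qed
        then have "of_nat m = (\<Sum>i\<in>idx ` T. 1 :: ennreal)"
          using T by (simp add: card_image)
        also have "\<dots> = (\<Sum>i\<in>idx ` T. indicator (I k i) t)"
        proof (rule sum.cong)
          fix i assume "i \<in> idx ` T"
          then obtain a where "a \<in> T" "i = idx a" by auto
          then have "t \<in> I k i" using inI[of a k i] idx[of a] T(1) by auto
          then show "1 = (indicator (I k i) t :: ennreal)" by simp
        qed simp
        also have "\<dots> \<le> N k t"
          unfolding N_def by (rule sum_le_suminf) (use T(2) in auto)
        finally show "of_nat m \<le> N k t" .
      qed
      then show ?thesis by (rule Liminf_bounded)
    qed
    then have "liminf (\<lambda>k. N k t) = \<infinity>"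
      by (metis ennreal_Ex_less_of_nat infinity_ennreal_def less_top linorder_not_less)
    then show False using liminf_fin by simp
  qed
  with t that show ?thesis by blast
qed

section \<open>Connectedness and accessibility\<close>

text \<open>
  A clopen set is determined by its trace on \<open>P\<close>, since the difference of two clopen sets with the
  same trace avoids \<open>P\<close>. So there are finitely many clopen sets, and the smallest one containing a
  given point is its component.
\<close>

lemma components_clopen_if_clopen_meets_finite:
  assumes "finite P"
    and meets: "\<And>Q. openin (top_of_set Y) Q \<Longrightarrow> closedin (top_of_set Y) Q \<Longrightarrow> Q \<noteq> {} \<Longrightarrow> Q \<inter> P \<noteq> {}"
  shows "finite (components Y)"
    and "\<And>C. C \<in> components Y \<Longrightarrow> openin (top_of_set Y) C \<and> closedin (top_of_set Y) C"
proof -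
  define \<Q> where "\<Q> = {Q. openin (top_of_set Y) Q \<and> closedin (top_of_set Y) Q}"
  have diff: "Q - Q' \<in> \<Q>" if "Q \<in> \<Q>" "Q' \<in> \<Q>" for Q Q'
    using that unfolding \<Q>_def by (auto intro: openin_diff closedin_diff)
  have sub: "Q \<subseteq> Q'" if "Q \<in> \<Q>" "Q' \<in> \<Q>" "Q \<inter> P = Q' \<inter> P" for Q Q'
    using meets[of "Q - Q'"] diff[OF that(1,2)] that(3) unfolding \<Q>_def by blast
  have "inj_on (\<lambda>Q. Q \<inter> P) \<Q>"
    by (rule inj_onI) (use sub in blast)
  moreover have "finite ((\<lambda>Q. Q \<inter> P) ` \<Q>)"
    by (rule finite_subset[of _ "Pow P"]) (use \<open>finite P\<close> in auto)
  ultimately have fin: "finite \<Q>" by (metis finite_imageD)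
  have comp: "C \<in> \<Q>" if C: "C \<in> components Y" for C
  proof -
    obtain y where y: "y \<in> Y" "C = connected_component_set Y y"
      using C unfolding components_iff by blast
    define Z where "Z = \<Inter>{Q \<in> \<Q>. y \<in> Q}"
    have "Y \<in> \<Q>" by (simp add: \<Q>_def)
    then have ne: "{Q \<in> \<Q>. y \<in> Q} \<noteq> {}" using y by auto
    have Z: "Z \<in> \<Q>"
    proof -
      have "finite {Q \<in> \<Q>. y \<in> Q}" using fin by simp
      then have "openin (top_of_set Y) Z"
        unfolding Z_def by (rule openin_Inter) (use ne in \<open>auto simp: \<Q>_def\<close>)
      moreover have "closedin (top_of_set Y) Z"
        unfolding Z_def by (rule closedin_Inter) (use ne in \<open>auto simp: \<Q>_def\<close>)
      ultimately show ?thesis by (simp add: \<Q>_def)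
    qed
    then have "Z \<subseteq> Y" unfolding \<Q>_def by (auto dest: openin_imp_subset)
    have "y \<in> Z" by (auto simp: Z_def)
    have "connected Z"
      unfolding connected_clopen
    proof (intro allI impI)
      fix T assume T: "openin (top_of_set Z) T \<and> closedin (top_of_set Z) T"
      then have TQ: "T \<in> \<Q>"
        using Z unfolding \<Q>_def using closedin_trans openin_trans by blast
      have "T \<subseteq> Z" using T by (auto dest: openin_imp_subset)
      show "T = {} \<or> T = Z"
      proof (cases "y \<in> T")
        case True then show ?thesis using TQ \<open>T \<subseteq> Z\<close> unfolding Z_def by blast
      next
        case False
        then have "Z \<subseteq> Z - T" using diff[OF Z TQ] \<open>y \<in> Z\<close> unfolding Z_def by blast
        then show ?thesis using \<open>T \<subseteq> Z\<close> by blast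
      qed
    qed
    then have "Z \<subseteq> C" using y \<open>y \<in> Z\<close> \<open>Z \<subseteq> Y\<close> by (simp add: connected_component_maximal)
    moreover have "C \<subseteq> Z"
    proof -
      have "connected C" "C \<subseteq> Y" "y \<in> C" using y by (auto simp: connected_component_subset)
      obtain U V where "open U" "closed V" "Z = Y \<inter> U" "Z = Y \<inter> V"
        using Z unfolding \<Q>_def openin_open closedin_closed by auto
      then have "C \<inter> Z = C \<inter> U" "C \<inter> Z = C \<inter> V" using \<open>C \<subseteq> Y\<close> by auto
      then have "closedin (top_of_set C) (C \<inter> Z)" "openin (top_of_set C) (C \<inter> Z)"
        using \<open>open U\<close> \<open>closed V\<close> unfolding openin_open closedin_closed by auto
      then have "C \<inter> Z = {} \<or> C \<inter> Z = C"
        using \<open>connected C\<close> unfolding connected_clopen by blast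
      then show ?thesis using \<open>y \<in> C\<close> \<open>y \<in> Z\<close> by blast
    qed
    ultimately show ?thesis using Z by simp
  qed
  then have "components Y \<subseteq> \<Q>" by blast
  then show "finite (components Y)" using fin by (rule finite_subset)
  show "\<And>C. C \<in> components Y \<Longrightarrow> openin (top_of_set Y) C \<and> closedin (top_of_set Y) C"
    using comp by (simp add: \<Q>_def)
qed

lemma interval_minus_finite_pieces:
  fixes a b :: real
  assumes "finite F"
  shows "\<exists>\<A>. finite \<A> \<and> (\<forall>A\<in>\<A>. connected A) \<and> \<Union>\<A> = {a..<b} - F"
  using assms
proof (induction F)
  case empty
  show ?case by (rule exI[of _ "{{a..<b}}"]) auto
next
  case (insert p F)
  then obtain \<A> where A: "finite \<A>" "\<And>A. A \<in> \<A> \<Longrightarrow> connected A" "\<Union>\<A> = {a..<b} - F"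
    by blast
  let ?\<B> = "(\<lambda>A. A \<inter> {..<p}) ` \<A> \<union> (\<lambda>A. A \<inter> {p<..}) ` \<A>"
  have "connected B" if "B \<in> ?\<B>" for B
    using that A(2)
    by (auto simp flip: is_interval_connected_1 intro!: is_interval_Int is_interval_io is_interval_oi)
  moreover have "\<Union>?\<B> = {a..<b} - insert p F"
  proof -
    have "\<Union>?\<B> = \<Union>\<A> - {p}" by auto
    then show ?thesis using A(3) by auto
  qed
  ultimately show ?case using A(1) by (intro exI[of _ ?\<B>]) auto
qed

lemma circle_minus_finite_pieces:
  fixes x :: complex
  assumes "t > 0" "finite (K \<inter> sphere x t)"
  obtains \<A> where "finite \<A>" "\<And>A. A \<in> \<A> \<Longrightarrow> connected A" "\<Union>\<A> = sphere x t - K"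
proof -
  define f where "f \<theta> = x + of_real t * cis \<theta>" for \<theta>
  have f_onto: "\<exists>\<theta>\<in>{0..<2*pi}. z = f \<theta>" if "z \<in> sphere x t" for z
  proof -
    have "cmod (z - x) = t" using that by (simp add: dist_norm norm_minus_commute)
    then have "z - x = of_real t * exp (\<i> * of_real (Arg2pi (z - x)))"
      by (metis Arg2pi_eq)
    then have "z = f (Arg2pi (z - x))"
      by (simp add: f_def cis_conv_exp algebra_simps)
    then show ?thesis using Arg2pi[of "z - x"] by auto
  qed
  have f_in: "f \<theta> \<in> sphere x t" for \<theta>
    using \<open>t > 0\<close> by (simp add: f_def dist_norm norm_mult)
  have "inj_on f {0..<2*pi}"
  proof (rule inj_onI)
    fix a b assume ab: "a \<in> {0..<2*pi}" "b \<in> {0..<2*pi}" "f a = f b"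
    then have "cis a = cis b" using \<open>t > 0\<close> by (simp add: f_def)
    moreover have "Arg2pi (cis c) = c" if "c \<in> {0..<2*pi}" for c
      by (rule Arg2pi_unique[of 1]) (use that in \<open>auto simp: cis_conv_exp\<close>)
    ultimately show "a = b" using ab by metis
  qed
  then have "finite ({0..<2*pi} \<inter> f -` (K \<inter> sphere x t))"
    using finite_vimage_IntI[OF assms(2)] by (metis inf_commute)
  then obtain \<A> where A: "finite \<A>" "\<And>A. A \<in> \<A> \<Longrightarrow> connected A"
      "\<Union>\<A> = {0..<2*pi} - ({0..<2*pi} \<inter> f -` (K \<inter> sphere x t))"
    using interval_minus_finite_pieces by metis
  have "continuous_on S f" for S unfolding f_def by (intro continuous_intros)
  then have "connected B" if "B \<in> (`) f ` \<A>" for B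
    using that A(2) connected_continuous_image by auto
  moreover have "\<Union>((`) f ` \<A>) = f ` \<Union>\<A>" by auto
  moreover have "f ` \<Union>\<A> = sphere x t - K"
    unfolding A(3) using f_onto f_in by fastforce
  ultimately show ?thesis using that[of "(`) f ` \<A>"] A(1) by auto
qed

lemma arc_in_punctured_circle:
  fixes x :: complex
  assumes "t > 0" and e: "e1 \<in> sphere x t" "e2 \<in> sphere x t" "e3 \<in> sphere x t"
    "e1 \<noteq> e2" "e1 \<noteq> e3" "e2 \<noteq> e3"
  obtains c where "arc c" "pathstart c = e1" "pathfinish c = e2" "path_image c \<subseteq> sphere x t - {e3}"
proof -
  have "sphere x t - {e3} homeomorphic {z::complex. 1 \<bullet> z = 0}"
    using assms by (intro homeomorphic_punctured_sphere_hyperplane) auto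
  moreover have "path_connected {z::complex. 1 \<bullet> z = 0}"
    by (intro convex_imp_path_connected convex_hyperplane)
  ultimately have "path_connected (sphere x t - {e3})"
    using homeomorphic_path_connectedness by blast
  then obtain p where p: "path p" "path_image p \<subseteq> sphere x t - {e3}" "pathstart p = e1" "pathfinish p = e2"
    using e unfolding path_connected_def by blast
  obtain c where "arc c" "path_image c \<subseteq> path_image p" "pathstart c = e1" "pathfinish c = e2"
    using path_contains_arc[OF p(1,3,4) \<open>e1 \<noteq> e2\<close>] by blast
  with that p show ?thesis by blast
qed

text \<open>
  Infinitely many consecutive paths can be concatenated to one path if they shrink to a point. The
  time scale is \<open>s = 1 / (1 - u) - 1\<close>, which maps the half-open unit interval to the half-line.
\<close>

lemma path_to_limit_of_shrinking_paths:
  fixes x :: "'a::metric_space"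
  assumes links: "\<And>n. path_component (S n) (d n) (d (Suc n))"
    and shrink: "\<And>n. S n \<subseteq> ball x (\<epsilon> n)" "\<epsilon> \<longlonglongrightarrow> 0"
    and inT: "\<And>n. S n \<subseteq> T"
  obtains p where "path p" "pathstart p = d 0" "pathfinish p = x" "path_image p \<subseteq> insert x T"
proof -
  have "\<forall>n. \<exists>g. path g \<and> path_image g \<subseteq> S n \<and> pathstart g = d n \<and> pathfinish g = d (Suc n)"
    using links unfolding path_component_def by blast
  then obtain g where g: "\<And>n. path (g n)" "\<And>n. path_image (g n) \<subseteq> S n"
      "\<And>n. g n 0 = d n" "\<And>n. g n 1 = d (Suc n)"
    unfolding pathstart_def pathfinish_def by metis
  have gS: "g n u \<in> S n" if "u \<in> {0..1}" for n u
    using g(2)[of n] that by (auto simp: path_image_def)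
  \<comment> \<open>The concatenation runs through \<open>g n\<close> on the time interval from \<open>n\<close> to \<open>n + 1\<close>.\<close>
  define h where "h s = g (nat \<lfloor>s\<rfloor>) (s - of_int \<lfloor>s\<rfloor>)" for s :: real
  have hS: "h s \<in> S (nat \<lfloor>s\<rfloor>)" if "s \<ge> 0" for s
  proof -
    have "s - of_int \<lfloor>s\<rfloor> \<in> {0..1}" by simp linarith
    then show ?thesis unfolding h_def by (rule gS)
  qed
  have h_piece: "h s = g n (s - of_nat n)" if "s \<in> {of_nat n .. of_nat n + 1}" for n s
  proof (cases "s = of_nat n + 1")
    case True
    then have "\<lfloor>s\<rfloor> = int n + 1" by simp
    then have "h s = g (Suc n) 0" using True by (simp add: h_def nat_add_distrib)
    then show ?thesis using True g(3,4) by simp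
  next
    case False
    then have "\<lfloor>s\<rfloor> = int n" using that by (auto simp: floor_eq_iff)
    then show ?thesis by (simp add: h_def)
  qed
  have h_cont: "continuous_on {0..real n} h" for n
  proof (induction n)
    case (Suc n)
    have "continuous_on {of_nat n .. of_nat n + 1} (\<lambda>s. g n (s - of_nat n))"
      by (rule continuous_on_compose2[of "{0..1}" "g n"])
        (use g(1)[of n] in \<open>auto simp: path_def intro!: continuous_intros\<close>)
    then have "continuous_on {of_nat n .. of_nat n + 1} h"
      using h_piece by (subst continuous_on_cong[OF refl]) auto
    then have "continuous_on ({0..real n} \<union> {of_nat n .. of_nat n + 1}) h"
      using Suc by (intro continuous_on_closed_Un) auto
    moreover have "{0..real n} \<union> {of_nat n .. of_nat n + 1} = {0..real (Suc n)}" by auto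
    ultimately show ?case by simp
  qed simp
  define p where "p u = (if u < 1 then h (1 / (1 - u) - 1) else x)" for u :: real
  have arg_nonneg: "1 / (1 - u) - 1 \<ge> 0" if "0 \<le> u" "u < 1" for u :: real
    using that by (simp add: field_simps)
  have p_cont: "continuous_on {0..v} p" if "v < 1" for v
  proof -
    obtain N where N: "1 / (1 - v) - 1 \<le> real N" using real_arch_simple by blast
    have "continuous_on {0..v} (\<lambda>u. h (1 / (1 - u) - 1))"
    proof (rule continuous_on_compose2[OF h_cont[of N]])
      show "continuous_on {0..v} (\<lambda>u. 1 / (1 - u) - 1)"
        using that by (intro continuous_intros) auto
      show "(\<lambda>u. 1 / (1 - u) - 1) ` {0..v} \<subseteq> {0..real N}"
      proof clarify
        fix u assume u: "u \<in> {0..v}"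
        then have "1 / (1 - u) \<le> 1 / (1 - v)" using that by (intro divide_left_mono) auto
        then show "1 / (1 - u) - 1 \<in> {0..real N}" using N arg_nonneg[of u] u that by auto
      qed
    qed
    then show ?thesis
      by (rule continuous_on_eq) (use that in \<open>auto simp: p_def\<close>)
  qed
  have "continuous (at u within {0..1}) p" if u: "u \<in> {0..1}" for u
  proof (cases "u < 1")
    case True
    have "continuous_on {0..(u+1)/2} p" using True by (intro p_cont) auto
    then have "continuous (at u within {0..(u+1)/2}) p"
      using u True by (auto simp: continuous_on_eq_continuous_within)
    moreover have "at u within {0..(u+1)/2} = at u within {0..1}"
      by (rule at_within_nhd[of u "{..<(u+1)/2}"]) (use True in auto)
    ultimately show ?thesis by simp
  next
    case False
    then have [simp]: "u = 1" using u by auto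
    have "(p \<longlongrightarrow> x) (at 1 within {0..1})"
    proof (rule tendstoI)
      fix e :: real assume "e > 0"
      then have "\<forall>\<^sub>F n in sequentially. \<epsilon> n < e" using shrink(2) by (rule order_tendstoD(2)[rotated])
      then obtain n where n: "\<And>m. m \<ge> n \<Longrightarrow> \<epsilon> m < e" by (auto simp: eventually_sequentially)
      have "dist (p w) x < e" if w: "w \<in> {0..1}" "w \<noteq> 1" "dist w 1 < 1 / (real n + 1)" for w
      proof -
        have w1: "w < 1" "1 - w < 1 / (real n + 1)" using w by (auto simp: dist_real_def)
        then have "real n + 1 < 1 / (1 - w)" by (simp add: field_simps)
        then have "n \<le> nat \<lfloor>1 / (1 - w) - 1\<rfloor>" by linarith
        moreover have "p w \<in> S (nat \<lfloor>1 / (1 - w) - 1\<rfloor>)"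
          using hS[OF arg_nonneg[of w]] w w1 by (simp add: p_def)
        ultimately show ?thesis using shrink(1) n by (fastforce simp: dist_commute)
      qed
      then show "\<forall>\<^sub>F w in at 1 within {0..1}. dist (p w) x < e"
        unfolding eventually_at by (intro exI[of _ "1 / (real n + 1)"]) auto
    qed
    then show ?thesis by (simp add: continuous_within p_def)
  qed
  then have "path p" by (simp add: path_def continuous_on_eq_continuous_within)
  moreover have "pathstart p = d 0" using g(3)[of 0] by (simp add: pathstart_def p_def h_def)
  moreover have "pathfinish p = x" by (simp add: pathfinish_def p_def)
  moreover have "path_image p \<subseteq> insert x T"
  proof -
    have "p u \<in> insert x T" if "u \<in> {0..1}" for u
      using hS[OF arg_nonneg[of u]] inT that by (auto simp: p_def)
    then show ?thesis unfolding path_image_def by blast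
  qed
  ultimately show ?thesis by (rule that)
qed

lemma connected_meets_sphere:
  fixes x :: "'a::metric_space"
  assumes "connected D" "a \<in> D" "a \<in> cball x t" "b \<in> D" "b \<notin> ball x t"
  shows "D \<inter> sphere x t \<noteq> {}"
proof -
  have "connected (dist x ` D)"
    using assms(1) by (intro connected_continuous_image continuous_intros)
  then have "t \<in> dist x ` D"
    by (rule connectedD_interval[of _ "dist x a" "dist x b"]) (use assms in auto)
  then show ?thesis by auto
qed

lemma closure_Union_finite: "finite F \<Longrightarrow> closure (\<Union>F) = \<Union>(closure ` F)"
  by (induction rule: finite_induct) auto

text \<open>
  A component of \<open>D \<inter> cball x t\<close> that avoided the sphere would be clopen in \<open>D\<close> and so equal to \<open>D\<close>,
  which leaves the ball. So each component swallows one of the finitely many pieces on the sphere.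
\<close>

lemma finite_components_near_frontier_point:
  fixes D :: "'a::real_normed_vector set"
  assumes "open D" "connected D" "d \<in> D" "d \<notin> cball x t"
    and \<A>: "finite \<A>" "\<And>A. A \<in> \<A> \<Longrightarrow> connected A" "\<Union>\<A> = D \<inter> sphere x t"
  shows "finite (components (D \<inter> cball x t))"
proof -
  have meets: "E \<inter> sphere x t \<noteq> {}" if E: "E \<in> components (D \<inter> cball x t)" for E
  proof
    assume no: "E \<inter> sphere x t = {}"
    have "E \<subseteq> D \<inter> cball x t" "connected E" "E \<noteq> {}"
      using E by (auto dest: in_components_subset in_components_connected in_components_nonempty)
    then have Eb: "E \<subseteq> D \<inter> ball x t" using no by force
    have "E \<in> components (D \<inter> ball x t)"
      by (rule components_intermediate_subset[OF E Eb]) auto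
    then have "open E" using open_components[OF open_Int[OF \<open>open D\<close> open_ball]] by blast
    then have "openin (top_of_set D) E" using Eb by (intro open_openin_trans \<open>open D\<close>) auto
    moreover have "closedin (top_of_set D) E"
    proof -
      have "closedin (top_of_set (D \<inter> cball x t)) E" using E by (rule closedin_component)
      moreover have "closedin (top_of_set D) (D \<inter> cball x t)"
        by (simp add: closedin_closed_Int)
      ultimately show ?thesis by (rule closedin_trans)
    qed
    ultimately have "E = D" using \<open>connected D\<close> \<open>E \<noteq> {}\<close> unfolding connected_clopen by blast
    then show False using Eb assms(3,4) by auto
  qed
  have "\<forall>E\<in>components (D \<inter> cball x t). \<exists>A\<in>\<A>. A \<noteq> {} \<and> A \<subseteq> E"
  proof
    fix E assume E: "E \<in> components (D \<inter> cball x t)"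
    then obtain e where e: "e \<in> E" "e \<in> sphere x t" using meets by blast
    then have "e \<in> D" using in_components_subset[OF E] by blast
    then obtain A where A: "A \<in> \<A>" "e \<in> A" using e \<A>(3) by blast
    then have "A \<subseteq> D \<inter> cball x t" using \<A>(3) by force
    then have "A \<subseteq> E" using components_maximal[OF E \<A>(2)[OF A(1)]] A e by blast
    then show "\<exists>A\<in>\<A>. A \<noteq> {} \<and> A \<subseteq> E" using A by blast
  qed
  then obtain f where f: "\<And>E. E \<in> components (D \<inter> cball x t) \<Longrightarrow> f E \<in> \<A> \<and> f E \<noteq> {} \<and> f E \<subseteq> E"
    by metis
  have "inj_on f (components (D \<inter> cball x t))"
  proof (rule inj_onI)
    fix E E' assume E: "E \<in> components (D \<inter> cball x t)" "E' \<in> components (D \<inter> cball x t)" "f E = f E'"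
    then have "E \<inter> E' \<noteq> {}" using f[of E] f[of E'] by blast
    then show "E = E'" using components_nonoverlap[OF E(1,2)] by blast
  qed
  moreover have "finite (f ` components (D \<inter> cball x t))"
    by (rule finite_subset[OF _ \<A>(1)]) (use f in blast)
  ultimately show ?thesis by (metis finite_imageD)
qed

text \<open>
  A frontier point is accessible if small spheres about it meet \<open>D\<close> in finitely many pieces: then
  among the finitely many components of \<open>D \<inter> cball x t\<close> one has \<open>x\<close> in its closure, this choice can
  be repeated inside that component for smaller radii, and paths inside the nested components lead
  to \<open>x\<close>.
\<close>

lemma path_to_frontier_point:
  fixes D :: "'a::real_normed_vector set"
  assumes "open D" "connected D" "x \<in> closure D" "x \<notin> D" "d \<in> D"
    and slices: "\<And>\<rho>. 0 < \<rho> \<Longrightarrow> \<exists>t. 0 < t \<and> t < \<rho> \<and>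
      (\<exists>\<A>. finite \<A> \<and> (\<forall>A\<in>\<A>. connected A) \<and> \<Union>\<A> = D \<inter> sphere x t)"
  obtains p where "path p" "pathstart p = d" "pathfinish p = x" "path_image p \<subseteq> insert x D"
proof -
  have finite_pieces: "\<exists>t. 0 < t \<and> t < \<rho> \<and> finite (components (D \<inter> cball x t))"
    if \<rho>: "0 < \<rho>" "\<rho> \<le> dist x d" for \<rho>
  proof -
    obtain t \<A> where t: "0 < t" "t < \<rho>" and \<A>: "finite \<A>" "\<forall>A\<in>\<A>. connected A" "\<Union>\<A> = D \<inter> sphere x t"
      using slices[OF \<rho>(1)] by blast
    have "d \<notin> cball x t" using t \<rho> by simp
    then have "finite (components (D \<inter> cball x t))"
      using finite_components_near_frontier_point[OF assms(1,2,5)] \<A> by blast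
    then show ?thesis using t by blast
  qed
  have "0 < dist x d" using assms(4,5) by auto
  have touch: "\<exists>E'\<in>components (D \<inter> cball x t). x \<in> closure E' \<and> E \<inter> E' \<noteq> {}"
    if "0 < t" and fin: "finite (components (D \<inter> cball x t))" and E: "E \<subseteq> D" "x \<in> closure E" for t E
  proof -
    let ?\<C> = "{E'\<in>components (D \<inter> cball x t). E \<inter> E' \<noteq> {}}"
    have "x \<in> closure (E \<inter> ball x t)"
      using open_Int_closure_subset[OF open_ball, of x t E] E(2) \<open>0 < t\<close> by (auto simp: Int_commute)
    moreover have "E \<inter> ball x t \<subseteq> \<Union>?\<C>"
    proof
      fix y assume y: "y \<in> E \<inter> ball x t"
      then have "y \<in> D \<inter> cball x t" using E by auto
      then obtain E' where "E' \<in> components (D \<inter> cball x t)" "y \<in> E'"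
        using Union_components by blast
      then show "y \<in> \<Union>?\<C>" using y by blast
    qed
    ultimately have "x \<in> closure (\<Union>?\<C>)" using closure_mono by blast
    then have "x \<in> \<Union>(closure ` ?\<C>)"
      using fin by (simp add: closure_Union_finite)
    then show ?thesis by blast
  qed
  \<comment> \<open>A state is a radius with a component of the part of \<open>D\<close> in that closed ball, touching \<open>x\<close>.\<close>
  define state where "state n s \<longleftrightarrow> 0 < fst s \<and> fst s < 1 / (real n + 1) \<and>
      snd s \<in> components (D \<inter> cball x (fst s)) \<and> x \<in> closure (snd s)" for n :: nat and s :: "real \<times> 'a set"
  have "\<exists>s. state 0 s"
  proof -
    obtain t where t: "0 < t" "t < min 1 (dist x d)" "finite (components (D \<inter> cball x t))"
      using finite_pieces[of "min 1 (dist x d)"] \<open>0 < dist x d\<close> by auto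
    obtain E' where "E' \<in> components (D \<inter> cball x t)" "x \<in> closure E'"
      using touch[OF t(1,3) order_refl assms(3)] by blast
    then have "state 0 (t, E')" using t by (simp add: state_def)
    then show ?thesis by blast
  qed
  moreover have "\<exists>s'. state (Suc n) s' \<and> snd s' \<subseteq> snd s" if s: "state n s" for n s
  proof -
    define \<rho> where "\<rho> = min (1 / (real n + 2)) (min (fst s) (dist x d))"
    have "0 < \<rho>" "\<rho> \<le> dist x d"
      using \<open>0 < dist x d\<close> s by (auto simp: \<rho>_def state_def)
    then obtain t where t: "0 < t" "t < \<rho>" "finite (components (D \<inter> cball x t))"
      using finite_pieces by blast
    have sub: "snd s \<subseteq> D \<inter> cball x (fst s)" and sC: "snd s \<in> components (D \<inter> cball x (fst s))"
      using s unfolding state_def by (auto dest: in_components_subset)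
    obtain E' where E': "E' \<in> components (D \<inter> cball x t)" "x \<in> closure E'" "snd s \<inter> E' \<noteq> {}"
      using touch[OF t(1,3)] s sub unfolding state_def by blast
    have "E' \<subseteq> snd s"
    proof (rule components_maximal[OF sC _ _ E'(3)])
      show "connected E'" using E'(1) by (rule in_components_connected)
      show "E' \<subseteq> D \<inter> cball x (fst s)" using in_components_subset[OF E'(1)] t(2) by (auto simp: \<rho>_def)
    qed
    moreover have "state (Suc n) (t, E')" using t E' by (simp add: state_def \<rho>_def add.commute)
    ultimately show ?thesis by force
  qed
  ultimately obtain s where s: "\<And>n. state n (s n)" and nested: "\<And>n. snd (s (Suc n)) \<subseteq> snd (s n)"
    using dependent_nat_choice[of state "\<lambda>_ s s'. snd s' \<subseteq> snd s"] by blast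
  have s_pos: "0 < fst (s n)" and s_small: "fst (s n) < 1 / (real n + 1)"
    and s_comp: "snd (s n) \<in> components (D \<inter> cball x (fst (s n)))" for n
    using s[of n] by (auto simp: state_def)
  have "\<forall>n. \<exists>y. y \<in> snd (s n)" using s_comp in_components_nonempty by blast
  then obtain e where e: "\<And>n. e n \<in> snd (s n)" by metis
  define S where "S n = D \<inter> ball x (1 / (real n + 1))" for n :: nat
  have "path_component (S n) (e n) (e (Suc n))" for n
  proof -
    have "snd (s n) \<subseteq> S n"
      using in_components_subset[OF s_comp[of n]] s_small[of n] by (auto simp: S_def)
    then have "connected_component (S n) (e n) (e (Suc n))"
      using e[of n] e[of "Suc n"] nested[of n] in_components_connected[OF s_comp[of n]]
      unfolding connected_component_def by blast
    moreover have "open (S n)" using \<open>open D\<close> by (auto simp: S_def)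
    ultimately show ?thesis by (simp add: open_path_connected_component)
  qed
  moreover have "(\<lambda>n. 1 / (real n + 1)) \<longlonglongrightarrow> 0"
    using LIMSEQ_Suc[OF lim_1_over_n[where 'a=real]] by (simp add: add.commute)
  ultimately obtain p where p: "path p" "pathstart p = e 0" "pathfinish p = x" "path_image p \<subseteq> insert x D"
    using path_to_limit_of_shrinking_paths[of S e x "\<lambda>n. 1 / (real n + 1)" D] by (auto simp: S_def)
  have "e 0 \<in> D" using e[of 0] in_components_subset[OF s_comp[of 0]] by blast
  moreover have "path_connected D" using assms(1,2) by (simp add: connected_open_path_connected)
  ultimately obtain q where q: "path q" "path_image q \<subseteq> D" "pathstart q = d" "pathfinish q = e 0"
    using \<open>d \<in> D\<close> unfolding path_connected_def by blast
  have "path_image (q +++ p) \<subseteq> insert x D"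
    using path_image_join_subset[of q p] q(2) p(4) by blast
  then show ?thesis using that[of "q +++ p"] p q by simp
qed

section \<open>Branch points\<close>

text \<open>
  The pieces are components of \<open>L - {x}\<close> in the whole of \<open>L\<close>, not germs at \<open>x\<close>: a vertex of a
  theta-shaped curve \<open>L\<close> does not qualify, because the curve stays connected without it.
\<close>

definition branch_point :: "'a::topological_space set \<Rightarrow> 'a \<Rightarrow> bool" where
  "branch_point L x \<longleftrightarrow> (\<exists>\<W>. card \<W> = 3 \<and> \<W> \<subseteq> components (L - {x}) \<and> (\<forall>W\<in>\<W>. x \<in> closure W))"

text \<open>
  Let \<open>R x\<close> be the relation on \<open>P\<close> of lying in the same component of \<open>L - {x}\<close>. If \<open>x\<close> and \<open>y\<close> are
  different branch points, then two of the pieces at \<open>x\<close> avoid \<open>y\<close>, and together with \<open>x\<close> they form a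
  connected set that avoids \<open>y\<close>. So two points of \<open>P\<close> are related by \<open>R y\<close> but not by \<open>R x\<close>.
\<close>

lemma finite_branch_points:
  fixes L :: "'a::topological_space set"
  assumes "finite P"
    and meets: "\<And>x W. x \<in> X \<Longrightarrow> W \<in> components (L - {x}) \<Longrightarrow> W \<inter> P \<noteq> {}"
  shows "finite {x \<in> L \<inter> X. branch_point L x}"
proof -
  let ?B = "{x \<in> L \<inter> X. branch_point L x}"
  define R where "R x = {(p, q) \<in> P \<times> P. connected_component (L - {x}) p q}" for x
  have "inj_on R ?B"
  proof (rule inj_onI, rule ccontr)
    fix x y assume x: "x \<in> ?B" and y: "y \<in> ?B" and R: "R x = R y" and "x \<noteq> y"
    obtain \<W> where \<W>: "card \<W> = 3" "\<W> \<subseteq> components (L - {x})" "\<And>W. W \<in> \<W> \<Longrightarrow> x \<in> closure W"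
      using x unfolding branch_point_def by blast
    have "finite \<W>" using \<W>(1) card.infinite by force
    have "card {W \<in> \<W>. y \<in> W} \<le> 1"
    proof (rule card_le_Suc0_iff_eq[THEN iffD2, folded One_nat_def])
      show "finite {W \<in> \<W>. y \<in> W}" using \<open>finite \<W>\<close> by simp
      show "\<forall>W\<in>{W \<in> \<W>. y \<in> W}. \<forall>W'\<in>{W \<in> \<W>. y \<in> W}. W = W'"
        using \<W>(2) components_nonoverlap by blast
    qed
    moreover have "card \<W> = card {W \<in> \<W>. y \<in> W} + card {W \<in> \<W>. y \<notin> W}"
      using \<open>finite \<W>\<close> by (subst card_Un_disjoint[symmetric]) (auto intro: arg_cong[where f=card])
    ultimately have "2 \<le> card {W \<in> \<W>. y \<notin> W}" using \<W>(1) by linarith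
    then obtain \<V> where "\<V> \<subseteq> {W \<in> \<W>. y \<notin> W}" "card \<V> = 2"
      by (meson obtain_subset_with_card_n)
    then obtain V W where VW: "V \<in> \<W>" "W \<in> \<W>" "y \<notin> V" "y \<notin> W" "V \<noteq> W"
      by (auto simp: card_2_iff)
    have comp: "V \<in> components (L - {x})" "W \<in> components (L - {x})" using VW \<W>(2) by auto
    obtain p q where p: "p \<in> V" "p \<in> P" and q: "q \<in> W" "q \<in> P"
      using meets[OF _ comp(1)] meets[OF _ comp(2)] x by blast
    have "connected (insert x V)" "connected (insert x W)"
      using in_components_connected[OF comp(1)] in_components_connected[OF comp(2)]
        \<W>(3)[OF VW(1)] \<W>(3)[OF VW(2)] closure_subset
      by (auto intro: connected_intermediate_closure[OF _ subset_insertI])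
    then have "connected (insert x V \<union> insert x W)" by (intro connected_Un) auto
    moreover have "insert x V \<union> insert x W \<subseteq> L - {y}"
      using in_components_subset[OF comp(1)] in_components_subset[OF comp(2)] VW x \<open>x \<noteq> y\<close> by auto
    ultimately have "connected_component (L - {y}) p q"
      unfolding connected_component_def using p q by blast
    then have "(p, q) \<in> R x" using R p q by (simp add: R_def)
    then have "connected_component (L - {x}) p q" by (simp add: R_def)
    then have "q \<in> V"
      using comp(1) p(1) by (auto simp: components_iff intro: connected_component_trans)
    then show False using components_nonoverlap[OF comp] VW(5) q(1) by blast
  qed
  moreover have "finite (R ` ?B)"
    by (rule finite_subset[of _ "Pow (P \<times> P)"]) (use \<open>finite P\<close> in \<open>auto simp: R_def\<close>)
  ultimately show ?thesis by (metis finite_imageD)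
qed

section \<open>Irreducible separators\<close>

text \<open>
  These are the topological traces of quasiminimality: the third assumption is what remains of
  locally finite length, the fourth what remains of minimality.
\<close>

locale irreducible_separator =
  fixes \<Omega> K :: "complex set"
  assumes open_domain: "open \<Omega>"
    and closedin_domain: "closedin (top_of_set \<Omega>) K"
    and finite_circles: "\<And>x \<rho>. x \<in> K \<Longrightarrow> 0 < \<rho> \<Longrightarrow>
      \<exists>t. 0 < t \<and> t < \<rho> \<and> cball x t \<subseteq> \<Omega> \<and> finite (K \<inter> sphere x t)"
    and no_proper_competitor: "\<And>x r F. x \<in> K \<Longrightarrow> 0 < r \<Longrightarrow> cball x r \<subseteq> \<Omega> \<Longrightarrow> F \<subseteq> K \<Longrightarrow>
      topological_competitor \<Omega> K x r F \<Longrightarrow> F = K"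
begin

lemma K_subset: "K \<subseteq> \<Omega>"
  using closedin_domain by (rule closedin_imp_subset)

lemma open_complement: "open (\<Omega> - K)"
proof -
  have "openin (top_of_set \<Omega>) (\<Omega> - K)" using closedin_domain by (simp add: openin_diff)
  then show ?thesis using open_domain openin_open_eq by blast
qed

lemma open_component: "C \<in> components (\<Omega> - K) \<Longrightarrow> open C"
  using open_components[OF open_complement] .

lemma component_subset: "C \<in> components (\<Omega> - K) \<Longrightarrow> C \<subseteq> \<Omega> - K"
  by (rule in_components_subset)

lemma component_unique:
  "C \<in> components (\<Omega> - K) \<Longrightarrow> C' \<in> components (\<Omega> - K) \<Longrightarrow> y \<in> C \<Longrightarrow> y \<in> C' \<Longrightarrow> C = C'"
  using components_nonoverlap by blast

lemma in_some_component:
  assumes "y \<in> \<Omega> - K"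
  obtains C where "C \<in> components (\<Omega> - K)" "y \<in> C"
  using assms Union_components by blast

lemma closure_component:
  assumes C: "C \<in> components (\<Omega> - K)" and y: "y \<in> closure C" "y \<in> \<Omega>" "y \<notin> C"
  shows "y \<in> K"
proof (rule ccontr)
  assume "y \<notin> K"
  then obtain C' where C': "C' \<in> components (\<Omega> - K)" "y \<in> C'"
    using y(2) in_some_component by blast
  then have "C' \<inter> C \<noteq> {}"
    using open_Int_closure_eq_empty[OF open_component] y(1) by blast
  then show False using C C' y(3) component_unique by blast
qed

lemma compact_disc_part:
  assumes "cball x0 t \<subseteq> \<Omega>"
  shows "compact (K \<inter> cball x0 t)"
proof -
  obtain C where "closed C" "K = \<Omega> \<inter> C" using closedin_domain by (auto simp: closedin_closed)
  then have "K \<inter> cball x0 t = C \<inter> cball x0 t" using assms by auto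
  then show ?thesis using \<open>closed C\<close> by (simp add: closed_Int_compact)
qed

text \<open>
  Otherwise \<open>Q\<close> could be erased from \<open>K\<close>: the compact set \<open>insert x Q\<close> lies inside the disc, so it
  does not separate points outside, and it meets the remaining set \<open>K - Q\<close> only in \<open>x\<close>. By
  Janiszewski's theorem, points that \<open>K - Q\<close> does not separate are not separated by \<open>K\<close> either.
\<close>

lemma clopen_meets_circle:
  assumes x0: "x0 \<in> K" and t: "0 < t" "cball x0 t \<subseteq> \<Omega>" and x: "x \<in> K \<inter> ball x0 t"
    and Q: "openin (top_of_set (K \<inter> cball x0 t - {x})) Q"
      "closedin (top_of_set (K \<inter> cball x0 t - {x})) Q" "Q \<noteq> {}"
  shows "Q \<inter> (K \<inter> sphere x0 t) \<noteq> {}"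
proof
  assume empty: "Q \<inter> (K \<inter> sphere x0 t) = {}"
  define L where "L = K \<inter> cball x0 t"
  have QL: "Q \<subseteq> L - {x}" using Q(1) openin_imp_subset unfolding L_def by blast
  then have Qb: "Q \<subseteq> K \<inter> ball x0 t" using empty by (force simp: L_def)
  obtain U where U: "open U" "Q = (L - {x}) \<inter> U" using Q(1) unfolding L_def openin_open by blast
  obtain V where V: "closed V" "Q = (L - {x}) \<inter> V" using Q(2) unfolding L_def closedin_closed by blast
  obtain C where C: "closed C" "K = \<Omega> \<inter> C" using closedin_domain by (auto simp: closedin_closed)
  define N where "N = ball x0 t \<inter> U - {x}"
  have "open N" unfolding N_def using U(1) by (intro open_Diff open_Int) auto
  have QN: "Q = K \<inter> N"
  proof
    show "Q \<subseteq> K \<inter> N" using Qb U(2) QL by (auto simp: N_def)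
    show "K \<inter> N \<subseteq> Q" unfolding U(2) by (auto simp: N_def L_def)
  qed
  define F where "F = K - Q"
  have F: "F = \<Omega> \<inter> (C - N)" using C QN by (auto simp: F_def)
  then have F_closedin: "closedin (top_of_set \<Omega>) F"
    using closedin_closed_Int[OF closed_Diff[OF C(1) \<open>open N\<close>]] by simp
  have "openin (top_of_set \<Omega>) (\<Omega> - F)" using F_closedin by (simp add: openin_diff)
  then have "open (\<Omega> - F)" using open_domain openin_open_eq by blast
  then have closedT: "closed (F \<union> - \<Omega>)" by (simp add: closed_def Diff_eq Int_commute)
  have "insert x Q = insert x (L \<inter> V)" using V(2) by auto
  then have compactS: "compact (insert x Q)"
    using compact_disc_part[OF t(2)] V(1) by (simp add: L_def compact_Int_closed)
  have ST: "insert x Q \<inter> (F \<union> - \<Omega>) = {x}"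
    using x QL Qb K_subset by (auto simp: F_def)
  have SuT: "- (insert x Q \<union> (F \<union> - \<Omega>)) = \<Omega> - K"
    using x Qb K_subset by (auto simp: F_def)
  have Tc: "- (F \<union> - \<Omega>) = \<Omega> - F" by auto
  have "topological_competitor \<Omega> K x0 t F"
    unfolding topological_competitor_def
  proof (intro conjI ballI impI notI)
    show "closedin (top_of_set \<Omega>) F" by (rule F_closedin)
    show "F - ball x0 t = K - ball x0 t" using Qb by (auto simp: F_def)
    fix u v assume u: "u \<in> \<Omega> - (ball x0 t \<union> K)" and v: "v \<in> \<Omega> - (ball x0 t \<union> K)"
      and ne: "connected_component_set (\<Omega> - K) u \<noteq> connected_component_set (\<Omega> - K) v"
      and eq: "connected_component_set (\<Omega> - F) u = connected_component_set (\<Omega> - F) v"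
    have "v \<in> \<Omega> - F" using v by (auto simp: F_def)
    then have "connected_component (\<Omega> - F) u v" using eq by (metis connected_component_refl mem_Collect_eq)
    then have cT: "connected_component (- (F \<union> - \<Omega>)) u v" unfolding Tc .
    have "connected (- ball x0 t)" by (rule connected_complement_bounded_convex) auto
    moreover have "- ball x0 t \<subseteq> - insert x Q" using x Qb by auto
    ultimately have cS: "connected_component (- insert x Q) u v"
      unfolding connected_component_def using u v by blast
    have "connected_component (\<Omega> - K) u v"
      using Janiszewski[OF compactS closedT _ cS cT] unfolding ST SuT by simp
    then show False using ne connected_component_eq by fastforce
  qed
  then have "F = K" using no_proper_competitor[OF x0 t] by (auto simp: F_def)
  then show False using Q(3) Qb by (auto simp: F_def)
qed

context
  fixes x0 t x
  assumes x0: "x0 \<in> K" and t: "0 < t" "cball x0 t \<subseteq> \<Omega>" "finite (K \<inter> sphere x0 t)"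
    and x: "x \<in> K \<inter> ball x0 t"
begin

lemma finite_pieces: "finite (components (K \<inter> cball x0 t - {x}))"
  using components_clopen_if_clopen_meets_finite(1)[OF t(3)] clopen_meets_circle[OF x0 t(1,2) x]
  by blast

lemma piece_meets_circle:
  assumes "W \<in> components (K \<inter> cball x0 t - {x})"
  shows "W \<inter> (K \<inter> sphere x0 t) \<noteq> {}"
proof -
  have "openin (top_of_set (K \<inter> cball x0 t - {x})) W \<and> closedin (top_of_set (K \<inter> cball x0 t - {x})) W"
    using components_clopen_if_clopen_meets_finite(2)[OF t(3) _ assms] clopen_meets_circle[OF x0 t(1,2) x]
    by blast
  then show ?thesis
    using clopen_meets_circle[OF x0 t(1,2) x] in_components_nonempty[OF assms] by blast
qed

end

lemma finite_branch_points_in_disc: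
  assumes "x0 \<in> K" "0 < t" "cball x0 t \<subseteq> \<Omega>" "finite (K \<inter> sphere x0 t)"
  shows "finite {x \<in> K \<inter> ball x0 t. branch_point (K \<inter> cball x0 t) x}"
proof -
  have "finite {x \<in> (K \<inter> cball x0 t) \<inter> (K \<inter> ball x0 t). branch_point (K \<inter> cball x0 t) x}"
    by (rule finite_branch_points[OF assms(4)]) (use piece_meets_circle[OF assms] in blast)
  moreover have "(K \<inter> cball x0 t) \<inter> (K \<inter> ball x0 t) = K \<inter> ball x0 t" by auto
  ultimately show ?thesis by simp
qed

end

section \<open>Sectors cut out by three spokes\<close>

definition spoke :: "complex \<Rightarrow> real \<Rightarrow> complex \<Rightarrow> (real \<Rightarrow> complex) \<Rightarrow> bool" where
  "spoke x0 R x g \<longleftrightarrow> arc g \<and> pathstart g = x \<and> pathfinish g \<in> sphere x0 R \<and>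
     path_image g - {pathfinish g} \<subseteq> ball x0 R"

lemma spokeD:
  assumes "spoke x0 R x g"
  shows "arc g" "pathstart g = x" "pathfinish g \<in> sphere x0 R" "path_image g \<subseteq> cball x0 R"
    "path_image g \<inter> sphere x0 R = {pathfinish g}" "x \<in> ball x0 R" "x \<in> path_image g"
    "pathfinish g \<in> path_image g"
proof -
  have g: "arc g" "pathstart g = x" "pathfinish g \<in> sphere x0 R"
     "path_image g - {pathfinish g} \<subseteq> ball x0 R"
    using assms unfolding spoke_def by auto
  have ends: "x \<in> path_image g" "pathfinish g \<in> path_image g"
    using g(2) pathstart_in_path_image pathfinish_in_path_image by metis+
  have "x \<noteq> pathfinish g" using arc_distinct_ends[OF g(1)] g(2) by simp
  then show "arc g" "pathstart g = x" "pathfinish g \<in> sphere x0 R" "path_image g \<subseteq> cball x0 R"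
    "path_image g \<inter> sphere x0 R = {pathfinish g}" "x \<in> ball x0 R" "x \<in> path_image g"
    "pathfinish g \<in> path_image g"
    using g ends by (force dest: subsetD)+
qed

text \<open>
  Two spokes and an arc of the circle between their endpoints form a Jordan curve, whose inside is
  the sector.
\<close>

lemma sector_of_two_spokes:
  assumes g: "spoke x0 R x g1" "spoke x0 R x g2" "path_image g1 \<inter> path_image g2 = {x}"
    and c: "arc c" "pathstart c = pathfinish g1" "pathfinish c = pathfinish g2" "path_image c \<subseteq> sphere x0 R"
    and J: "J = path_image g1 \<union> path_image g2 \<union> path_image c"
  shows "open (inside J)" "connected (inside J)" "frontier (inside J) = J"
    "inside J \<subseteq> ball x0 R" "open (outside J)"
proof -
  note g1 = spokeD[OF g(1)] and g2 = spokeD[OF g(2)]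
  have arc1: "arc (g1 +++ c)"
    by (rule arc_join) (use g1 c in auto)
  have "simple_path ((g1 +++ c) +++ reversepath g2)"
  proof (rule simple_path_join_loop[OF arc1])
    show "arc (reversepath g2)" using g2(1) by (simp add: arc_reversepath)
    have "path_image (g1 +++ c) = path_image g1 \<union> path_image c"
      using c(2) by (simp add: path_image_join)
    moreover have "path_image c \<inter> path_image g2 \<subseteq> {pathfinish g2}" using c(4) g2(5) by blast
    ultimately show "path_image (g1 +++ c) \<inter> path_image (reversepath g2)
        \<subseteq> {pathstart (g1 +++ c), pathstart (reversepath g2)}"
      using g(3) g1(2) by auto
  qed (use g1 g2 c in auto)
  moreover have loop: "path_image ((g1 +++ c) +++ reversepath g2) = J"
    unfolding J using c by (subst path_image_join; simp add: path_image_join)+ blast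
  moreover have "pathfinish ((g1 +++ c) +++ reversepath g2) = pathstart ((g1 +++ c) +++ reversepath g2)"
    using g1 g2 by simp
  ultimately have *: "open (inside J)" "connected (inside J)" "frontier (inside J) = J" "open (outside J)"
    using Jordan_inside_outside[of "(g1 +++ c) +++ reversepath g2"] by auto
  then show "open (inside J)" "connected (inside J)" "frontier (inside J) = J" "open (outside J)"
    by auto
  have "sphere x0 R \<subseteq> cball x0 R" by auto
  then have "J \<subseteq> cball x0 R" using g1(4) g2(4) c(4) unfolding J by blast
  then have "- cball x0 R \<subseteq> outside J" by (intro outside_subset_convex) auto
  then have "inside J \<subseteq> cball x0 R" using inside_Int_outside[of J] by blast
  then show "inside J \<subseteq> ball x0 R" using interior_maximal[OF _ *(1)] by (metis interior_cball)
qed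

text \<open>
  The endpoint of the third spoke lies on the bounding circle, outside the sector, and the spoke
  does not cross the boundary of the sector.
\<close>

lemma third_spoke_outside:
  assumes g: "spoke x0 R x g1" "spoke x0 R x g2" "path_image g1 \<inter> path_image g2 = {x}"
    and c: "arc c" "pathstart c = pathfinish g1" "pathfinish c = pathfinish g2" "path_image c \<subseteq> sphere x0 R"
    and J: "J = path_image g1 \<union> path_image g2 \<union> path_image c"
    and g3: "spoke x0 R x g3" "path_image g1 \<inter> path_image g3 = {x}" "path_image g2 \<inter> path_image g3 = {x}"
      "pathfinish g3 \<notin> path_image c"
  shows "path_image g3 - {x} \<subseteq> outside J"
proof -
  note s3 = spokeD[OF g3(1)]
  have "x \<noteq> pathfinish g3" using s3(3,6) by auto
  have "y \<notin> path_image c" if "y \<in> path_image g3" for y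
    using s3(5) c(4) g3(4) that by (metis IntI singletonD subsetD)
  then have "path_image c \<inter> path_image g3 = {}" by auto
  then have off: "path_image g3 - {x} \<subseteq> - J" using g3(2,3) unfolding J by blast
  have conn: "connected (path_image g3 - {x})"
  proof -
    have "g3 ` ({0..1} - {0}) = g3 ` {0..1} - g3 ` {0}"
      using s3(1) by (intro inj_on_image_set_diff[of g3 "{0..1}"]) (auto simp: arc_def)
    moreover have "{0..1} - {0} = {0<..1::real}" "g3 0 = x"
      using s3(2) by (auto simp: pathstart_def)
    ultimately have "path_image g3 - {x} = g3 ` {0<..1}" by (simp add: path_image_def)
    moreover have "continuous_on {0<..1} g3"
      using arc_imp_path[OF s3(1)] unfolding path_def by (rule continuous_on_subset) auto
    ultimately show ?thesis by (simp add: connected_continuous_image)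
  qed
  note sec = sector_of_two_spokes[OF g c J]
  have e3: "pathfinish g3 \<in> outside J"
  proof -
    have "pathfinish g3 \<in> - J" using off s3(8) \<open>x \<noteq> pathfinish g3\<close> by blast
    moreover have "pathfinish g3 \<notin> inside J" using sec(4) s3(3) by auto
    ultimately show ?thesis using inside_Un_outside[of J] by blast
  qed
  show ?thesis
  proof (rule ccontr)
    assume "\<not> ?thesis"
    then have "(path_image g3 - {x}) \<inter> inside J \<noteq> {}" using off inside_Un_outside[of J] by blast
    moreover have "(path_image g3 - {x}) \<inter> outside J \<noteq> {}" using e3 s3(8) \<open>x \<noteq> pathfinish g3\<close> by blast
    moreover have "path_image g3 - {x} \<subseteq> inside J \<union> outside J" using off by simp
    moreover have "inside J \<inter> outside J \<inter> (path_image g3 - {x}) = {}" by simp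
    ultimately show False
      using connectedD[OF conn sec(1,5)] by (metis Int_commute)
  qed
qed

text \<open>
  Since \<open>g3\<close> runs outside the first sector, that sector does not meet the boundary of the second
  one and lies on one side of it. This is the outside: the first sector has \<open>g2\<close> on its boundary,
  and \<open>g2\<close> runs outside the second sector.
\<close>

lemma sectors_disjoint:
  assumes s: "spoke x0 R x g1" "spoke x0 R x g2" "spoke x0 R x g3"
    and int: "path_image g1 \<inter> path_image g2 = {x}" "path_image g1 \<inter> path_image g3 = {x}"
      "path_image g2 \<inter> path_image g3 = {x}"
    and c: "arc c" "pathstart c = pathfinish g1" "pathfinish c = pathfinish g2"
      "path_image c \<subseteq> sphere x0 R - {pathfinish g3}"
    and c': "arc c'" "pathstart c' = pathfinish g1" "pathfinish c' = pathfinish g3"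
      "path_image c' \<subseteq> sphere x0 R - {pathfinish g2}"
    and J: "J = path_image g1 \<union> path_image g2 \<union> path_image c"
    and J': "J' = path_image g1 \<union> path_image g3 \<union> path_image c'"
  shows "inside J \<inter> inside J' = {}"
proof -
  have cs: "path_image c \<subseteq> sphere x0 R" "pathfinish g3 \<notin> path_image c"
    "path_image c' \<subseteq> sphere x0 R" "pathfinish g2 \<notin> path_image c'" using c(4) c'(4) by auto
  note sec = sector_of_two_spokes[OF s(1,2) int(1) c(1-3) cs(1) J]
  note sec' = sector_of_two_spokes[OF s(1,3) int(2) c'(1-3) cs(3) J']
  have out: "path_image g3 - {x} \<subseteq> outside J"
    using third_spoke_outside[OF s(1,2) int(1) c(1-3) cs(1) J s(3) int(2,3) cs(2)] .
  have out': "path_image g2 - {x} \<subseteq> outside J'"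
    using third_spoke_outside[OF s(1,3) int(2) c'(1-3) cs(3) J' s(2) int(1) _ cs(4)] int(3)
    by (simp add: Int_commute)
  have "inside J \<inter> J = {}" using inside_no_overlap by blast
  moreover have "x \<in> J" using spokeD(7)[OF s(1)] unfolding J by blast
  ultimately have "inside J \<inter> path_image g1 = {}" "inside J \<inter> path_image g3 = {}"
    using out inside_Int_outside[of J] unfolding J by blast+
  moreover have "inside J \<inter> path_image c' = {}"
  proof -
    have "ball x0 R \<inter> sphere x0 R = {}" by auto
    then show ?thesis using cs(3) sec(4) by blast
  qed
  ultimately have "inside J \<inter> J' = {}" unfolding J' by blast
  then have sub: "inside J \<subseteq> inside J' \<union> outside J'" by auto
  have "pathfinish g2 \<in> outside J'"
    using out' spokeD(8)[OF s(2)] spokeD(3,6)[OF s(2)] by auto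
  moreover have "pathfinish g2 \<in> closure (inside J)"
    using sec(3) spokeD(8)[OF s(2)] unfolding J frontier_def by blast
  ultimately have "outside J' \<inter> inside J \<noteq> {}"
    using open_Int_closure_eq_empty[OF sec'(5)] by blast
  then have "inside J' \<inter> inside J = {}"
    using connectedD[OF sec(2) sec'(1,5)] sub inside_Int_outside[of J'] by (auto simp: Int_commute)
  then show ?thesis by blast
qed

context irreducible_separator
begin

text \<open>
  On a small circle about \<open>x\<close> the set \<open>K\<close> leaves finitely many arcs, so \<open>x\<close> is accessible from \<open>D\<close>;
  the resulting path is cut where it first reaches the large circle.
\<close>

lemma spoke_to_frontier_point:
  assumes D: "D \<in> components (\<Omega> - K)" "x \<in> closure D" and x: "x \<in> K \<inter> ball x0 R"
    and meets: "D \<inter> sphere x0 R \<noteq> {}"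
  obtains g where "spoke x0 R x g" "path_image g \<subseteq> insert x D"
proof -
  have DK: "D \<subseteq> \<Omega> - K" using D(1) by (rule component_subset)
  obtain e where e: "e \<in> D" "e \<in> sphere x0 R" using meets by blast
  have slices: "\<exists>t. 0 < t \<and> t < \<rho> \<and>
      (\<exists>\<A>. finite \<A> \<and> (\<forall>A\<in>\<A>. connected A) \<and> \<Union>\<A> = D \<inter> sphere x t)"
    if \<rho>: "0 < \<rho>" for \<rho>
  proof -
    obtain t where t: "0 < t" "t < \<rho>" "cball x t \<subseteq> \<Omega>" "finite (K \<inter> sphere x t)"
      using finite_circles[OF _ \<rho>] x by blast
    obtain \<A> where \<A>: "finite \<A>" "\<And>A. A \<in> \<A> \<Longrightarrow> connected A" "\<Union>\<A> = sphere x t - K"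
      using circle_minus_finite_pieces[OF t(1,4)] by blast
    have sub: "A \<subseteq> D" if "A \<in> \<A>" "A \<inter> D \<noteq> {}" for A
    proof (rule components_maximal[OF D(1) \<A>(2)[OF that(1)]])
      show "A \<subseteq> \<Omega> - K" using \<A>(3) that(1) t(3) sphere_cball[of x t] by blast
    qed (use that in blast)
    have "\<Union>{A \<in> \<A>. A \<inter> D \<noteq> {}} = D \<inter> sphere x t"
    proof
      show "\<Union>{A \<in> \<A>. A \<inter> D \<noteq> {}} \<subseteq> D \<inter> sphere x t" using sub \<A>(3) by blast
      show "D \<inter> sphere x t \<subseteq> \<Union>{A \<in> \<A>. A \<inter> D \<noteq> {}}" using \<A>(3) DK by blast
    qed
    then show ?thesis
      using t \<A>(1,2) by (intro exI[of _ t] conjI exI[of _ "{A \<in> \<A>. A \<inter> D \<noteq> {}}"]) auto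
  qed
  obtain p where p: "path p" "pathstart p = e" "pathfinish p = x" "path_image p \<subseteq> insert x D"
    using path_to_frontier_point[OF open_component[OF D(1)] in_components_connected[OF D(1)] D(2) _ e(1) slices]
      x DK by blast
  have pf: "pathstart (reversepath p) \<in> closure (ball x0 R)" "pathfinish (reversepath p) \<notin> ball x0 R"
    using p x e closure_subset[of "ball x0 R"] by auto
  then obtain h where h: "path h" "pathstart h = x" "path_image h \<subseteq> path_image p"
      "path_image h - {pathfinish h} \<subseteq> interior (ball x0 R)" "pathfinish h \<in> frontier (ball x0 R)"
    using exists_path_subpath_to_frontier[OF _ pf] p(1,3) by (metis path_image_reversepath path_reversepath pathstart_reversepath)
  have "R > 0" using x by (metis Int_iff ball_eq_empty empty_iff linorder_not_le)
  then have hf: "pathfinish h \<in> sphere x0 R" using h(5) by simp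
  then have "x \<noteq> pathfinish h" using x by auto
  then obtain g where g: "arc g" "path_image g \<subseteq> path_image h" "pathstart g = x" "pathfinish g = pathfinish h"
    using path_contains_arc[OF h(1,2) refl] by blast
  have "spoke x0 R x g" using g h(4) hf unfolding spoke_def by auto
  then show ?thesis using that g(2) h(3) p(4) by blast
qed

text \<open>
  If \<open>K\<close> stayed away from \<open>x\<close> in the sector, split it, together with the bounding circle, into the
  closed parts \<open>A\<close> in the sector and \<open>B\<close> outside. Points of the two spokes near \<open>x\<close> are connected
  within a small disc about \<open>x\<close> off \<open>A\<close>, and through the sector off \<open>B\<close>. As \<open>A \<inter> B\<close> is the
  connected bounding circle, Janiszewski's theorem connects them off \<open>A \<union> B\<close>, so \<open>D1 = D2\<close>.
\<close>

lemma separator_accumulates_in_sector: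
  assumes disc: "cball x0 R \<subseteq> \<Omega>" and x: "x \<in> K"
    and D: "D1 \<in> components (\<Omega> - K)" "D2 \<in> components (\<Omega> - K)" "D1 \<noteq> D2"
    and g: "spoke x0 R x g1" "spoke x0 R x g2" "path_image g1 \<inter> path_image g2 = {x}"
      "path_image g1 \<subseteq> insert x D1" "path_image g2 \<subseteq> insert x D2"
    and c: "arc c" "pathstart c = pathfinish g1" "pathfinish c = pathfinish g2" "path_image c \<subseteq> sphere x0 R"
    and J: "J = path_image g1 \<union> path_image g2 \<union> path_image c"
  shows "x \<in> closure (K \<inter> inside J)"
proof (rule ccontr)
  assume not: "x \<notin> closure (K \<inter> inside J)"
  define S where "S = inside J"
  note sec = sector_of_two_spokes[OF g(1-3) c J, folded S_def]
  have DK: "D1 \<inter> K = {}" "D2 \<inter> K = {}" using component_subset[OF D(1)] component_subset[OF D(2)] by auto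
  have xb: "x \<in> ball x0 R" using spokeD(6)[OF g(1)] .
  have "open (ball x0 R - closure (K \<inter> S))" by (intro open_Diff) auto
  moreover have "x \<in> ball x0 R - closure (K \<inter> S)" using not xb by (simp add: S_def)
  ultimately obtain \<epsilon> where \<epsilon>: "\<epsilon> > 0" "ball x \<epsilon> \<subseteq> ball x0 R - closure (K \<inter> S)"
    unfolding open_contains_ball by blast
  have \<epsilon>K: "ball x \<epsilon> \<inter> (K \<inter> S) = {}" using \<epsilon>(2) closure_subset[of "K \<inter> S"] by blast
  define A where "A = (K \<inter> cball x0 R \<inter> closure S - ball x \<epsilon>) \<union> sphere x0 R"
  define B where "B = (K \<inter> cball x0 R - S) \<union> sphere x0 R"
  have cK: "compact (K \<inter> cball x0 R)" using disc by (rule compact_disc_part)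
  have compactA: "compact A"
    unfolding A_def
    by (intro compact_Un compact_diff compact_Int_closed[OF cK] closed_closure open_ball compact_sphere)
  have closedB: "closed B"
    unfolding B_def by (intro closed_Un closed_Diff compact_imp_closed[OF cK] sec(1) closed_sphere)
  have "K \<inter> J \<subseteq> insert x (sphere x0 R)"
    using g(4,5) DK c(4) unfolding J by blast
  moreover have "closure S \<subseteq> S \<union> J" using sec(3) unfolding frontier_def by (auto simp: interior_open[OF sec(1)])
  moreover have "x \<in> ball x \<epsilon>" using \<epsilon>(1) by simp
  ultimately have AB: "A \<inter> B = sphere x0 R" unfolding A_def B_def by blast
  have conAB: "connected (A \<inter> B)" unfolding AB by (rule connected_sphere) simp
  have AuB: "K \<inter> cball x0 R \<union> sphere x0 R \<subseteq> A \<union> B"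
    using \<epsilon>K closure_subset[of S] unfolding A_def B_def by blast
  have near: "\<exists>d \<delta>. d \<in> ball x \<epsilon> \<and> \<delta> > 0 \<and> ball d \<delta> \<subseteq> D \<inter> ball x0 R \<and> ball d \<delta> \<inter> S \<noteq> {}"
    if g': "spoke x0 R x g" "path_image g \<subseteq> insert x D" "path_image g \<subseteq> J" "open D" for g D
  proof -
    note sg = spokeD[OF g'(1)]
    have "x islimpt path_image g"
    proof (rule connected_imp_perfect)
      show "connected (path_image g)" using sg(1) by (rule connected_arc_image)
      have "x \<noteq> pathfinish g" using sg(3,6) by auto
      then show "path_image g \<noteq> {z}" for z using sg(7,8) by (metis singletonD)
    qed (rule sg(7))
    then obtain d where d: "d \<in> path_image g" "d \<in> ball x \<epsilon>" "d \<noteq> x"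
      using \<epsilon>(1) unfolding islimpt_approachable by (metis dist_commute mem_ball)
    have "d \<in> D \<inter> ball x0 R" using d g'(2) \<epsilon>(2) by blast
    moreover have "open (D \<inter> ball x0 R)" using g'(4) by auto
    ultimately obtain \<delta> where \<delta>: "\<delta> > 0" "ball d \<delta> \<subseteq> D \<inter> ball x0 R"
      unfolding open_contains_ball by blast
    have "d \<in> closure S" using d(1) g'(3) sec(3) unfolding frontier_def by blast
    then have "ball d \<delta> \<inter> S \<noteq> {}"
      using \<delta>(1) open_Int_closure_eq_empty[OF open_ball, of d \<delta> S] centre_in_ball by blast
    then show ?thesis using d(2) \<delta> by blast
  qed
  obtain d1 \<delta>1 where d1: "d1 \<in> ball x \<epsilon>" "\<delta>1 > 0" "ball d1 \<delta>1 \<subseteq> D1 \<inter> ball x0 R" "ball d1 \<delta>1 \<inter> S \<noteq> {}"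
    using near[OF g(1,4) _ open_component[OF D(1)]] unfolding J by blast
  obtain d2 \<delta>2 where d2: "d2 \<in> ball x \<epsilon>" "\<delta>2 > 0" "ball d2 \<delta>2 \<subseteq> D2 \<inter> ball x0 R" "ball d2 \<delta>2 \<inter> S \<noteq> {}"
    using near[OF g(2,5) _ open_component[OF D(2)]] unfolding J by blast
  have mem: "d1 \<in> D1" "d1 \<in> ball x0 R" "d2 \<in> D2" "d2 \<in> ball x0 R"
    using d1(2,3) d2(2,3) centre_in_ball by blast+
  have ball_sphere: "ball x0 R \<inter> sphere x0 R = {}" by auto
  have "ball x \<epsilon> \<subseteq> - A" using \<epsilon>(2) ball_sphere unfolding A_def by blast
  then have cA: "connected_component (- A) d1 d2"
    unfolding connected_component_def using d1(1) d2(1) by (intro exI[of _ "ball x \<epsilon>"]) auto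
  have "connected (ball d1 \<delta>1 \<union> S \<union> ball d2 \<delta>2)"
    using d1(4) d2(4) sec(2) by (intro connected_Un) auto
  moreover have "ball d1 \<delta>1 \<union> S \<union> ball d2 \<delta>2 \<subseteq> - B"
    using d1(3) d2(3) DK sec(4) ball_sphere unfolding B_def by blast
  ultimately have cB: "connected_component (- B) d1 d2"
    unfolding connected_component_def using d1(2) d2(2)
    by (intro exI[of _ "ball d1 \<delta>1 \<union> S \<union> ball d2 \<delta>2"]) auto
  obtain T where T: "connected T" "T \<subseteq> - (A \<union> B)" "d1 \<in> T" "d2 \<in> T"
    using Janiszewski[OF compactA closedB conAB cA cB] unfolding connected_component_def by blast
  have "T \<subseteq> ball x0 R"
  proof
    fix y assume "y \<in> T"
    have "T \<inter> sphere x0 R = {}" using T(2) unfolding A_def by blast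
    then show "y \<in> ball x0 R"
      using connected_meets_sphere[OF T(1,3) _ \<open>y \<in> T\<close>] mem(2) by (meson ball_subset_cball subsetD)
  qed
  then have "T \<subseteq> \<Omega> - K" using AuB T(2) disc ball_subset_cball[of x0 R] by blast
  then have "T \<subseteq> D1" "T \<subseteq> D2"
    using components_maximal[OF D(1) T(1)] components_maximal[OF D(2) T(1)] T(3,4) mem(1,3) by blast+
  then show False using component_unique[OF D(1,2)] T(3) D(3) by blast
qed

text \<open>
  Only finitely many pieces of \<open>K - {x}\<close> in the disc are involved, so one of those that meet the
  sector has \<open>x\<close> in its closure; it cannot leave the sector, whose boundary it does not meet.
\<close>

lemma sector_contains_piece:
  assumes x0: "x0 \<in> K" and t: "0 < t" "cball x0 t \<subseteq> \<Omega>" "finite (K \<inter> sphere x0 t)"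
    and x: "x \<in> K \<inter> ball x0 t"
    and S: "x \<in> closure (K \<inter> S)" "x \<notin> S" "frontier S \<inter> (K \<inter> cball x0 t) \<subseteq> {x}"
  obtains W where "W \<in> components (K \<inter> cball x0 t - {x})" "x \<in> closure W" "W \<subseteq> S"
proof -
  define L where "L = K \<inter> cball x0 t"
  define \<W> where "\<W> = {W \<in> components (L - {x}). W \<inter> S \<noteq> {}}"
  have fin: "finite \<W>" using finite_pieces[OF x0 t x] by (simp add: \<W>_def L_def)
  have "x \<in> closure (ball x0 t \<inter> (K \<inter> S))"
    using open_Int_closure_subset[OF open_ball, of x0 t "K \<inter> S"] S(1) x by blast
  moreover have "ball x0 t \<inter> (K \<inter> S) \<subseteq> \<Union>\<W>"
  proof
    fix y assume y: "y \<in> ball x0 t \<inter> (K \<inter> S)"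
    then have "y \<in> L - {x}" using S(2) by (auto simp: L_def)
    then obtain W where "W \<in> components (L - {x})" "y \<in> W" using Union_components by blast
    then show "y \<in> \<Union>\<W>" using y by (auto simp: \<W>_def)
  qed
  ultimately have "x \<in> closure (\<Union>\<W>)" using closure_mono by blast
  then obtain W where W: "W \<in> \<W>" "x \<in> closure W" using closure_Union_finite[OF fin] by blast
  have comp: "W \<in> components (L - {x})" using W(1) by (simp add: \<W>_def)
  have "W \<inter> frontier S = {}"
    using in_components_subset[OF comp] S(3) unfolding L_def by blast
  then have "W \<subseteq> S"
    using connected_Int_frontier[OF in_components_connected[OF comp], of S] W(1) unfolding \<W>_def by blast
  then show ?thesis using that comp W(2) unfolding L_def by blast
qed

text \<open>
  The sectors are formed in the larger disc of radius \<open>R\<close>. Their boundaries consist of arcs in the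
  complement of \<open>K\<close> and arcs of the outer circle, so within the smaller disc they meet \<open>K\<close> only in
  \<open>x\<close>.
\<close>

lemma branch_point_if_three_components:
  assumes x0: "x0 \<in> K" and t: "0 < t" "t < R" "cball x0 R \<subseteq> \<Omega>" "finite (K \<inter> sphere x0 t)"
    and x: "x \<in> K \<inter> ball x0 t"
    and \<D>: "\<D> \<subseteq> components (\<Omega> - K)" "card \<D> = 3"
      "\<And>D. D \<in> \<D> \<Longrightarrow> x \<in> closure D" "\<And>D. D \<in> \<D> \<Longrightarrow> D \<inter> sphere x0 R \<noteq> {}"
  shows "branch_point (K \<inter> cball x0 t) x"
proof -
  obtain D1 D2 D3 where D: "\<D> = {D1, D2, D3}" "D1 \<noteq> D2" "D2 \<noteq> D3" "D1 \<noteq> D3"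
    using \<D>(2) by (auto simp: card_3_iff)
  have xR: "x \<in> K \<inter> ball x0 R" using x t(2) by auto
  have tsub: "cball x0 t \<subseteq> \<Omega>" using t(2,3) by auto
  have comp: "D1 \<in> components (\<Omega> - K)" "D2 \<in> components (\<Omega> - K)" "D3 \<in> components (\<Omega> - K)"
    using \<D>(1) D(1) by auto
  have spoke_ex: "\<exists>g. spoke x0 R x g \<and> path_image g \<subseteq> insert x D" if "D \<in> \<D>" for D
    by (rule spoke_to_frontier_point[OF subsetD[OF \<D>(1) that] \<D>(3)[OF that] xR \<D>(4)[OF that]]) blast
  obtain g1 where g1: "spoke x0 R x g1" "path_image g1 \<subseteq> insert x D1" using spoke_ex D(1) by blast
  obtain g2 where g2: "spoke x0 R x g2" "path_image g2 \<subseteq> insert x D2" using spoke_ex D(1) by blast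
  obtain g3 where g3: "spoke x0 R x g3" "path_image g3 \<subseteq> insert x D3" using spoke_ex D(1) by blast
  have disj: "D1 \<inter> D2 = {}" "D1 \<inter> D3 = {}" "D2 \<inter> D3 = {}"
    using component_unique comp D by blast+
  have int: "path_image g1 \<inter> path_image g2 = {x}" "path_image g1 \<inter> path_image g3 = {x}"
      "path_image g2 \<inter> path_image g3 = {x}"
    using g1(2) g2(2) g3(2) disj spokeD(7)[OF g1(1)] spokeD(7)[OF g2(1)] spokeD(7)[OF g3(1)] by blast+
  then have int': "path_image g2 \<inter> path_image g1 = {x}" "path_image g3 \<inter> path_image g1 = {x}"
      "path_image g3 \<inter> path_image g2 = {x}"
    by blast+
  define e1 e2 e3 where "e1 = pathfinish g1" and "e2 = pathfinish g2" and "e3 = pathfinish g3"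
  have e: "e1 \<in> sphere x0 R" "e2 \<in> sphere x0 R" "e3 \<in> sphere x0 R"
    using spokeD(3)[OF g1(1)] spokeD(3)[OF g2(1)] spokeD(3)[OF g3(1)] by (auto simp: e1_def e2_def e3_def)
  have "e1 \<in> D1" "e2 \<in> D2" "e3 \<in> D3"
    using e xR spokeD(8)[OF g1(1)] spokeD(8)[OF g2(1)] spokeD(8)[OF g3(1)] g1(2) g2(2) g3(2)
    by (auto simp: e1_def e2_def e3_def)
  then have ne: "e1 \<noteq> e2" "e1 \<noteq> e3" "e2 \<noteq> e3" using disj by auto
  have "R > 0" using t by simp
  obtain c12 where c12: "arc c12" "pathstart c12 = pathfinish g1" "pathfinish c12 = pathfinish g2"
      "path_image c12 \<subseteq> sphere x0 R - {pathfinish g3}"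
    using arc_in_punctured_circle[OF \<open>R > 0\<close> e ne] unfolding e1_def e2_def e3_def by blast
  obtain c13 where c13: "arc c13" "pathstart c13 = pathfinish g1" "pathfinish c13 = pathfinish g3"
      "path_image c13 \<subseteq> sphere x0 R - {pathfinish g2}"
    using arc_in_punctured_circle[OF \<open>R > 0\<close> e(1,3,2) ne(2,1)] ne(3) unfolding e1_def e2_def e3_def by metis
  obtain c23 where c23: "arc c23" "pathstart c23 = pathfinish g2" "pathfinish c23 = pathfinish g3"
      "path_image c23 \<subseteq> sphere x0 R - {pathfinish g1}"
    using arc_in_punctured_circle[OF \<open>R > 0\<close> e(2,3,1) ne(3)] ne(1,2) unfolding e1_def e2_def e3_def by metis
  define J12 where "J12 = path_image g1 \<union> path_image g2 \<union> path_image c12"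
  define J13 where "J13 = path_image g1 \<union> path_image g3 \<union> path_image c13"
  define J23 where "J23 = path_image g2 \<union> path_image g3 \<union> path_image c23"
  have piece: "\<exists>W. W \<in> components (K \<inter> cball x0 t - {x}) \<and> x \<in> closure W \<and> W \<subseteq> inside J"
    if DD: "D \<in> components (\<Omega> - K)" "D' \<in> components (\<Omega> - K)" "D \<noteq> D'"
      and g: "spoke x0 R x g" "spoke x0 R x g'" "path_image g \<inter> path_image g' = {x}"
        "path_image g \<subseteq> insert x D" "path_image g' \<subseteq> insert x D'"
      and c: "arc c" "pathstart c = pathfinish g" "pathfinish c = pathfinish g'" "path_image c \<subseteq> sphere x0 R"
      and J: "J = path_image g \<union> path_image g' \<union> path_image c"
    for D D' g g' c J
  proof -
    have acc: "x \<in> closure (K \<inter> inside J)"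
      by (rule separator_accumulates_in_sector[OF t(3) _ DD g c J]) (use x in blast)
    have "x \<in> J" using spokeD(7)[OF g(1)] J by blast
    then have xS: "x \<notin> inside J" using inside_no_overlap[of J] by blast
    have "sphere x0 R \<inter> cball x0 t = {}" using t(2) by auto
    then have fr: "frontier (inside J) \<inter> (K \<inter> cball x0 t) \<subseteq> {x}"
      unfolding sector_of_two_spokes(3)[OF g(1-3) c J] unfolding J
      using g(4,5) c(4) component_subset[OF DD(1)] component_subset[OF DD(2)] by blast
    show ?thesis
      by (rule sector_contains_piece[OF x0 t(1) tsub t(4) x acc xS fr]) blast
  qed
  obtain W12 where W12: "W12 \<in> components (K \<inter> cball x0 t - {x})" "x \<in> closure W12" "W12 \<subseteq> inside J12"
    using piece[OF comp(1,2) D(2) g1(1) g2(1) int(1) g1(2) g2(2) c12(1-3) _ J12_def] c12(4) by blast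
  obtain W13 where W13: "W13 \<in> components (K \<inter> cball x0 t - {x})" "x \<in> closure W13" "W13 \<subseteq> inside J13"
    using piece[OF comp(1,3) D(4) g1(1) g3(1) int(2) g1(2) g3(2) c13(1-3) _ J13_def] c13(4) by blast
  obtain W23 where W23: "W23 \<in> components (K \<inter> cball x0 t - {x})" "x \<in> closure W23" "W23 \<subseteq> inside J23"
    using piece[OF comp(2,3) D(3) g2(1) g3(1) int(3) g2(2) g3(2) c23(1-3) _ J23_def] c23(4) by blast
  have rev: "arc (reversepath c)" "pathstart (reversepath c) = pathfinish c"
    "pathfinish (reversepath c) = pathstart c" "path_image (reversepath c) = path_image c"
    if "arc c" for c :: "real \<Rightarrow> complex"
    using that by (auto simp: arc_reversepath)
  have d1: "inside J12 \<inter> inside J13 = {}"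
    by (rule sectors_disjoint[OF g1(1) g2(1) g3(1) int c12 c13 J12_def J13_def])
  have d2: "inside J12 \<inter> inside J23 = {}"
  proof (rule sectors_disjoint[OF g2(1) g1(1) g3(1) int'(1) int(3,2), where c = "reversepath c12" and c' = c23])
    show "J12 = path_image g2 \<union> path_image g1 \<union> path_image (reversepath c12)"
      by (auto simp: J12_def)
  qed (use rev[OF c12(1)] c12 c23 J23_def in auto)
  have d3: "inside J13 \<inter> inside J23 = {}"
  proof (rule sectors_disjoint[OF g3(1) g1(1) g2(1) int'(2,3) int(1),
        where c = "reversepath c13" and c' = "reversepath c23"])
    show "J13 = path_image g3 \<union> path_image g1 \<union> path_image (reversepath c13)"
      by (auto simp: J13_def)
    show "J23 = path_image g3 \<union> path_image g2 \<union> path_image (reversepath c23)"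
      by (auto simp: J23_def)
  qed (use rev[OF c13(1)] rev[OF c23(1)] c13 c23 in auto)
  have "W12 \<noteq> {}" "W13 \<noteq> {}" "W23 \<noteq> {}"
    using W12(1) W13(1) W23(1) in_components_nonempty by blast+
  then have "W12 \<noteq> W13" "W12 \<noteq> W23" "W13 \<noteq> W23"
    using W12(3) W13(3) W23(3) d1 d2 d3 by blast+
  then have "card {W12, W13, W23} = 3" by simp
  then show ?thesis
    unfolding branch_point_def using W12 W13 W23 by (intro exI[of _ "{W12, W13, W23}"]) auto
qed

end

section \<open>Components crossing a circle\<close>

context irreducible_separator
begin

definition crossing_components :: "complex \<Rightarrow> real \<Rightarrow> complex set set" where
  "crossing_components x0 R = {C \<in> components (\<Omega> - K). C \<inter> sphere x0 R \<noteq> {}}"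

lemma crossing_componentsI:
  assumes "C \<in> components (\<Omega> - K)" "a \<in> C" "a \<in> ball x0 R" "b \<in> C" "b \<notin> ball x0 R"
  shows "C \<in> crossing_components x0 R"
proof -
  have "a \<in> cball x0 R" using assms(3) by auto
  then show ?thesis
    using connected_meets_sphere[OF in_components_connected[OF assms(1)] assms(2) _ assms(4,5)] assms(1)
    by (simp add: crossing_components_def)
qed

text \<open>
  Each crossing component contains one of the finitely many arcs that \<open>K\<close> leaves on the circle.
\<close>

lemma finite_crossing_components:
  assumes "0 < R" "cball x0 R \<subseteq> \<Omega>" "finite (K \<inter> sphere x0 R)"
  shows "finite (crossing_components x0 R)"
proof -
  obtain \<A> where \<A>: "finite \<A>" "\<And>A. A \<in> \<A> \<Longrightarrow> connected A" "\<Union>\<A> = sphere x0 R - K"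
    using circle_minus_finite_pieces[OF assms(1,3)] by blast
  have "\<exists>A\<in>\<A>. A \<noteq> {} \<and> A \<subseteq> C" if C: "C \<in> crossing_components x0 R" for C
  proof -
    have comp: "C \<in> components (\<Omega> - K)" using C by (simp add: crossing_components_def)
    obtain e where e: "e \<in> C" "e \<in> sphere x0 R" using C unfolding crossing_components_def by blast
    then have "e \<notin> K" using component_subset[OF comp] by blast
    then obtain A where A: "A \<in> \<A>" "e \<in> A" using e \<A>(3) by blast
    have "A \<subseteq> C"
    proof (rule components_maximal[OF comp \<A>(2)[OF A(1)]])
      show "A \<subseteq> \<Omega> - K" using \<A>(3) A(1) assms(2) sphere_cball[of x0 R] by blast
    qed (use A e in blast)
    then show ?thesis using A by blast
  qed
  then obtain f where f: "\<And>C. C \<in> crossing_components x0 R \<Longrightarrow> f C \<in> \<A> \<and> f C \<noteq> {} \<and> f C \<subseteq> C"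
    by metis
  have "inj_on f (crossing_components x0 R)"
  proof (rule inj_onI)
    fix C C' assume C: "C \<in> crossing_components x0 R" "C' \<in> crossing_components x0 R" "f C = f C'"
    then have "C \<inter> C' \<noteq> {}" using f[of C] f[of C'] by blast
    moreover have "C \<in> components (\<Omega> - K)" "C' \<in> components (\<Omega> - K)"
      using C by (simp_all add: crossing_components_def)
    ultimately show "C = C'" using components_nonoverlap by blast
  qed
  moreover have "finite (f ` crossing_components x0 R)"
    by (rule finite_subset[OF _ \<A>(1)]) (use f in blast)
  ultimately show ?thesis by (metis finite_imageD)
qed

text \<open>
  Let \<open>F\<close> arise from \<open>K\<close> by deleting, inside the disc, everything that is not in the closure of a
  crossing component other than \<open>C1\<close>. Those components keep their boundary, and components that do
  not meet the disc are unaffected. So among the components that reach outside only \<open>C1\<close> can grow,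
  no two of them are joined, and \<open>F\<close> is a competitor. Irreducibility says that nothing was deleted.
\<close>

lemma touched_by_another_crossing_component:
  assumes x0: "x0 \<in> K" and R: "0 < R" "cball x0 R \<subseteq> \<Omega>" "finite (K \<inter> sphere x0 R)"
    and y: "y \<in> K \<inter> ball x0 R"
  obtains C where "C \<in> crossing_components x0 R" "C \<noteq> C1" "y \<in> closure C"
proof -
  define \<C> where "\<C> = crossing_components x0 R - {C1}"
  have fin: "finite \<C>" using finite_crossing_components[OF R] by (simp add: \<C>_def)
  define V where "V = ball x0 R - \<Union>(closure ` \<C>)"
  have "open V" unfolding V_def using fin by (intro open_Diff closed_UN) auto
  define F where "F = K - V"
  obtain C' where C': "closed C'" "K = \<Omega> \<inter> C'" using closedin_domain by (auto simp: closedin_closed)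
  have "F = \<Omega> \<inter> (C' - V)" using C' by (auto simp: F_def)
  then have F_closedin: "closedin (top_of_set \<Omega>) F"
    using closedin_closed_Int[OF closed_Diff[OF C'(1) \<open>open V\<close>]] by simp
  \<comment> \<open>Every component other than \<open>C1\<close> that reaches outside the disc survives the removal of \<open>K \<inter> V\<close>.\<close>
  have survives: "connected_component_set (\<Omega> - F) u = connected_component_set (\<Omega> - K) u"
    if u: "u \<in> \<Omega> - (ball x0 R \<union> K)" "connected_component_set (\<Omega> - K) u \<noteq> C1" for u
  proof -
    define C where "C = connected_component_set (\<Omega> - K) u"
    have uC: "u \<in> C" and C: "C \<in> components (\<Omega> - K)"
      using u by (auto simp: C_def intro: componentsI)
    define E where "E = connected_component_set (\<Omega> - F) u"
    have "C \<subseteq> E" unfolding E_def C_def by (rule connected_component_mono) (auto simp: F_def)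
    have "connected E" "E \<subseteq> \<Omega> - F" by (auto simp: E_def connected_component_subset)
    have "E \<inter> closure C \<subseteq> C"
    proof
      fix z assume z: "z \<in> E \<inter> closure C"
      show "z \<in> C"
      proof (rule ccontr)
        assume "z \<notin> C"
        then have "z \<in> V" using closure_component[OF C, of z] z \<open>E \<subseteq> \<Omega> - F\<close> by (auto simp: F_def)
        then have "z \<in> ball x0 R" by (simp add: V_def)
        then obtain a where "a \<in> C" "a \<in> ball x0 R"
          using open_Int_closure_eq_empty[OF open_ball, of x0 R C] z by blast
        then have "C \<in> \<C>"
          using crossing_componentsI[OF C _ _ uC] u unfolding \<C>_def C_def by auto
        then show False using \<open>z \<in> V\<close> z unfolding V_def by blast
      qed
    qed
    then have "E \<subseteq> C \<union> - closure C" by blast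
    moreover have "C \<inter> - closure C \<inter> E = {}" using closure_subset[of C] by blast
    ultimately have "C \<inter> E = {} \<or> - closure C \<inter> E = {}"
      using connectedD[OF \<open>connected E\<close> open_component[OF C], of "- closure C"] by auto
    then have "E \<subseteq> C" using \<open>E \<subseteq> C \<union> - closure C\<close> uC \<open>C \<subseteq> E\<close> by blast
    then show ?thesis using \<open>C \<subseteq> E\<close> unfolding E_def C_def by blast
  qed
  have "topological_competitor \<Omega> K x0 R F"
    unfolding topological_competitor_def
  proof (intro conjI ballI impI notI)
    show "closedin (top_of_set \<Omega>) F" by (rule F_closedin)
    show "F - ball x0 R = K - ball x0 R" by (auto simp: F_def V_def)
    fix u v assume u: "u \<in> \<Omega> - (ball x0 R \<union> K)" and v: "v \<in> \<Omega> - (ball x0 R \<union> K)"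
      and ne: "connected_component_set (\<Omega> - K) u \<noteq> connected_component_set (\<Omega> - K) v"
      and eq: "connected_component_set (\<Omega> - F) u = connected_component_set (\<Omega> - F) v"
    have self: "u \<in> connected_component_set (\<Omega> - F) u" "v \<in> connected_component_set (\<Omega> - F) v"
      using u v by (auto simp: F_def)
    consider "connected_component_set (\<Omega> - K) u \<noteq> C1" | "connected_component_set (\<Omega> - K) v \<noteq> C1"
      using ne by blast
    then show False
    proof cases
      case 1
      then have "v \<in> connected_component_set (\<Omega> - K) u" using survives[OF u 1] eq self(2) by simp
      then show False using ne connected_component_eq by blast
    next
      case 2
      then have "u \<in> connected_component_set (\<Omega> - K) v" using survives[OF v 2] eq self(1) by simp
      then show False using ne connected_component_eq by blast
    qed
  qed
  then have "F = K" using no_proper_competitor[OF x0 R(1,2)] by (auto simp: F_def)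
  then have "y \<notin> V" using y by (auto simp: F_def)
  then show ?thesis using that y unfolding V_def \<C>_def by blast
qed

lemma two_crossing_components_touch:
  assumes "x0 \<in> K" "0 < R" "cball x0 R \<subseteq> \<Omega>" "finite (K \<inter> sphere x0 R)" "y \<in> K \<inter> ball x0 R"
  obtains C C' where "C \<in> crossing_components x0 R" "C' \<in> crossing_components x0 R" "C \<noteq> C'"
    "y \<in> closure C" "y \<in> closure C'"
  using touched_by_another_crossing_component[OF assms] by metis

text \<open>
  Each boundary point of such a component \<open>D\<close> in the disc touches \<open>D\<close> and two crossing components.
  Applied to small discs about a boundary point \<open>y0\<close>, the criterion for branch points shows that
  \<open>y0\<close> is an isolated boundary point of \<open>D\<close>. Then \<open>D\<close> contains a punctured disc about \<open>y0\<close>, although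
  a crossing component touches \<open>y0\<close> as well.
\<close>

lemma no_component_inside_disc:
  assumes x0: "x0 \<in> K" and R: "0 < R" "cball x0 R \<subseteq> \<Omega>" "finite (K \<inter> sphere x0 R)"
    and D: "D \<in> components (\<Omega> - K)"
  shows "\<not> D \<subseteq> ball x0 R"
proof
  assume inner: "D \<subseteq> ball x0 R"
  have ball\<Omega>: "ball x0 R \<subseteq> \<Omega>" using R(2) ball_subset_cball by blast
  have DK: "D \<inter> K = {}" using component_subset[OF D] by blast
  have not_crossing: "D \<notin> crossing_components x0 R"
    using inner by (force simp: crossing_components_def)
  have clopen: "G \<subseteq> D" if "connected G" "G \<subseteq> \<Omega>" "G \<inter> closure D \<inter> K = {}" "G \<inter> D \<noteq> {}" for G
  proof -
    have "G \<subseteq> D \<union> - closure D" using that(2,3) closure_component[OF D] by blast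
    moreover have "D \<inter> - closure D \<inter> G = {}" using closure_subset[of D] by blast
    ultimately show ?thesis
      using connectedD[OF that(1) open_component[OF D], of "- closure D"] that(4) by auto
  qed
  obtain y0 where y0: "y0 \<in> K" "y0 \<in> ball x0 R" "y0 \<in> closure D"
  proof (cases "ball x0 R \<inter> closure D \<inter> K = {}")
    case True
    have "ball x0 R \<inter> D \<noteq> {}" using inner in_components_nonempty[OF D] by blast
    then have "ball x0 R \<subseteq> D" using clopen[OF connected_ball ball\<Omega> True] by blast
    then show ?thesis using x0 DK R(1) centre_in_ball by blast
  qed (use that in blast)
  obtain d where d: "d \<in> D" using in_components_nonempty[OF D] by blast
  have "d \<noteq> y0" using d y0(1) DK by blast
  obtain \<eta> where \<eta>: "\<eta> > 0" "cball y0 \<eta> \<subseteq> ball x0 R"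
    using y0(2) open_ball open_contains_cball by blast
  define s' where "s' = min \<eta> (dist y0 d / 2)"
  have s': "s' > 0" "cball y0 s' \<subseteq> ball x0 R" "s' < dist y0 d"
    using \<eta> \<open>d \<noteq> y0\<close> by (auto simp: s'_def subset_iff min_less_iff_disj)
  obtain s where s: "0 < s" "s < s'" "cball y0 s \<subseteq> \<Omega>" "finite (K \<inter> sphere y0 s)"
    using finite_circles[OF y0(1) s'(1)] by blast
  have s'\<Omega>: "cball y0 s' \<subseteq> \<Omega>" using s'(2) ball\<Omega> by blast
  have branch: "branch_point (K \<inter> cball y0 s) y" if y: "y \<in> K \<inter> ball y0 s" "y \<in> closure D" for y
  proof -
    have "y \<in> ball x0 R" using y(1) s(2) s'(2) by (auto simp: subset_iff)
    then obtain C C' where C: "C \<in> crossing_components x0 R" "C' \<in> crossing_components x0 R" "C \<noteq> C'"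
      "y \<in> closure C" "y \<in> closure C'"
      using two_crossing_components_touch[OF x0 R] y(1) by blast
    have out: "E \<inter> sphere y0 s' \<noteq> {}"
      if E: "E \<in> components (\<Omega> - K)" "y \<in> closure E" "b \<in> E" "b \<notin> ball y0 s'" for E b
    proof -
      have "y \<in> ball y0 s'" using y(1) s(2) by auto
      then obtain a where "a \<in> E" "a \<in> ball y0 s'"
        using open_Int_closure_eq_empty[OF open_ball, of y0 s' E] E(2) by blast
      then show ?thesis
        using crossing_componentsI[OF E(1) _ _ E(3,4)] by (simp add: crossing_components_def)
    qed
    have far: "E \<inter> sphere y0 s' \<noteq> {}" if E: "E \<in> crossing_components x0 R" "y \<in> closure E" for E
    proof -
      obtain b where b: "b \<in> E" "b \<in> sphere x0 R" using E(1) unfolding crossing_components_def by blast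
      have "b \<notin> ball x0 R" using b(2) by auto
      then have "b \<notin> ball y0 s'" using s'(2) ball_subset_cball by blast
      then show ?thesis using out[of E b] E b(1) by (simp add: crossing_components_def)
    qed
    have "D \<inter> sphere y0 s' \<noteq> {}" using out[OF D y(2) d] s'(3) by simp
    moreover have "C \<noteq> D" "C' \<noteq> D" using C(1,2) not_crossing by auto
    ultimately show ?thesis
      using C D y far
      by (intro branch_point_if_three_components[OF y0(1) s(1,2) s'\<Omega> s(4) y(1), of "{D, C, C'}"])
        (auto simp: crossing_components_def)
  qed
  have "finite {y \<in> K \<inter> ball y0 s. branch_point (K \<inter> cball y0 s) y}"
    by (rule finite_branch_points_in_disc[OF y0(1) s(1,3,4)])
  then have fin: "finite (K \<inter> ball y0 s \<inter> closure D)"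
    by (rule rev_finite_subset) (use branch in auto)
  obtain \<delta>0 where \<delta>0: "\<delta>0 > 0" "\<And>z. z \<in> K \<inter> ball y0 s \<inter> closure D \<Longrightarrow> z \<noteq> y0 \<Longrightarrow> \<delta>0 \<le> dist y0 z"
    using finite_set_avoid[OF fin, of y0] by blast
  define \<delta> where "\<delta> = min \<delta>0 s"
  have \<delta>: "\<delta> > 0" "ball y0 \<delta> \<subseteq> ball y0 s" "ball y0 \<delta> \<subseteq> \<Omega>"
    using \<delta>0(1) s(1,3) by (auto simp: \<delta>_def subset_iff)
  define G where "G = ball y0 \<delta> - {y0}"
  have "G \<inter> closure D \<inter> K = {}"
  proof -
    have False if "z \<in> G" "z \<in> closure D" "z \<in> K" for z
      using \<delta>0(2)[of z] that \<delta>(2) by (auto simp: G_def \<delta>_def)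
    then show ?thesis by blast
  qed
  moreover have "connected G" unfolding G_def by (rule connected_punctured_ball) simp
  moreover have meets: "G \<inter> E \<noteq> {}" if "E \<inter> K = {}" "y0 \<in> closure E" for E
  proof -
    have "ball y0 \<delta> \<inter> E \<noteq> {}"
      using open_Int_closure_eq_empty[OF open_ball, of y0 \<delta> E] that(2) \<delta>(1) centre_in_ball by blast
    then show ?thesis using that(1) y0(1) unfolding G_def by blast
  qed
  moreover have "G \<subseteq> \<Omega>" using \<delta>(3) unfolding G_def by blast
  ultimately have "G \<subseteq> D" using clopen DK y0(3) by blast
  obtain C where C: "C \<in> crossing_components x0 R" "C \<noteq> D" "y0 \<in> closure C"
    using touched_by_another_crossing_component[OF x0 R] y0(1,2) by blast
  have comp: "C \<in> components (\<Omega> - K)" using C(1) by (simp add: crossing_components_def)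
  then have "G \<inter> C \<noteq> {}" using meets[OF _ C(3)] component_subset by blast
  then show False using \<open>G \<subseteq> D\<close> component_unique[OF comp D] C(2) by blast
qed

text \<open>
  Since every component that meets the disc crosses its boundary, only finitely many are involved,
  and a small ball about \<open>x\<close> meets exactly those that touch \<open>x\<close>. There are at least two of them, and
  exactly two would make \<open>x\<close> an interface point.
\<close>

lemma branch_point_if_not_interface:
  assumes x0: "x0 \<in> K" and R: "cball x0 R \<subseteq> \<Omega>" "finite (K \<inter> sphere x0 R)"
    and t: "0 < t" "t < R" "finite (K \<inter> sphere x0 t)"
    and x: "x \<in> K \<inter> ball x0 t" "x \<notin> interface_points \<Omega> K"
  shows "branch_point (K \<inter> cball x0 t) x"
proof -
  have "0 < R" using t by simp
  note disc = x0 \<open>0 < R\<close> R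
  have xR: "x \<in> K \<inter> ball x0 R" using x t(2) by auto
  define \<T> where "\<T> = {C \<in> crossing_components x0 R. x \<in> closure C}"
  define U where "U = ball x0 R - \<Union>(closure ` (crossing_components x0 R - \<T>))"
  have fin: "finite (crossing_components x0 R)" using finite_crossing_components[OF \<open>0 < R\<close> R] .
  have "open U" unfolding U_def using fin by (intro open_Diff closed_UN) auto
  moreover have "x \<in> U" using xR by (auto simp: U_def \<T>_def)
  ultimately obtain r where r: "r > 0" "ball x r \<subseteq> U" unfolding open_contains_ball by blast
  have r\<Omega>: "ball x r \<subseteq> \<Omega>" using r(2) R(1) ball_subset_cball unfolding U_def by blast
  have "{C \<in> components (\<Omega> - K). C \<inter> (ball x r - K) \<noteq> {}} = \<T>"
  proof (intro equalityI subsetI)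
    fix C assume "C \<in> {C \<in> components (\<Omega> - K). C \<inter> (ball x r - K) \<noteq> {}}"
    then obtain a where C: "C \<in> components (\<Omega> - K)" and a: "a \<in> C" "a \<in> ball x r" by blast
    obtain b where b: "b \<in> C" "b \<notin> ball x0 R" using no_component_inside_disc[OF disc C] by blast
    have "a \<in> U" using a(2) r(2) by blast
    then have "C \<in> crossing_components x0 R"
      using crossing_componentsI[OF C a(1) _ b] unfolding U_def by blast
    then show "C \<in> \<T>" using \<open>a \<in> U\<close> a(1) closure_subset[of C] unfolding U_def by blast
  next
    fix C assume C: "C \<in> \<T>"
    then have comp: "C \<in> components (\<Omega> - K)" "x \<in> closure C" by (auto simp: \<T>_def crossing_components_def)
    then have "ball x r \<inter> C \<noteq> {}"
      using open_Int_closure_eq_empty[OF open_ball, of x r C] r(1) centre_in_ball by blast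
    then show "C \<in> {C \<in> components (\<Omega> - K). C \<inter> (ball x r - K) \<noteq> {}}"
      using comp component_subset by blast
  qed
  then have "card \<T> \<noteq> 2"
    using x r(1) r\<Omega> unfolding interface_points_def by auto
  moreover have "2 \<le> card \<T>"
  proof -
    obtain C C' where C: "C \<in> crossing_components x0 R" "C' \<in> crossing_components x0 R" "C \<noteq> C'"
      "x \<in> closure C" "x \<in> closure C'"
      using two_crossing_components_touch[OF disc xR] by blast
    have "finite \<T>" using fin by (simp add: \<T>_def)
    moreover have "{C, C'} \<subseteq> \<T>" using C by (auto simp: \<T>_def)
    ultimately have "card {C, C'} \<le> card \<T>" by (rule card_mono)
    then show ?thesis using C(3) by simp
  qed
  ultimately have "3 \<le> card \<T>" by linarith
  then obtain \<D> where \<D>: "\<D> \<subseteq> \<T>" "card \<D> = 3" by (meson obtain_subset_with_card_n)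
  show ?thesis
    by (rule branch_point_if_three_components[OF x0 t(1,2) R(1) t(3) x(1) _ \<D>(2)])
      (use \<D>(1) in \<open>auto simp: \<T>_def crossing_components_def\<close>)
qed

theorem locally_finite_noninterface_points:
  assumes x0: "x0 \<in> K"
  obtains t where "t > 0" "finite ((K - interface_points \<Omega> K) \<inter> ball x0 t)"
proof -
  obtain R where R: "0 < R" "cball x0 R \<subseteq> \<Omega>" "finite (K \<inter> sphere x0 R)"
    using finite_circles[OF x0, of 1] by auto
  obtain t where t: "0 < t" "t < R" "cball x0 t \<subseteq> \<Omega>" "finite (K \<inter> sphere x0 t)"
    using finite_circles[OF x0 R(1)] by blast
  have "(K - interface_points \<Omega> K) \<inter> ball x0 t \<subseteq> {x \<in> K \<inter> ball x0 t. branch_point (K \<inter> cball x0 t) x}"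
    using branch_point_if_not_interface[OF x0 R(2,3) t(1,2,4)] by blast
  then have "finite ((K - interface_points \<Omega> K) \<inter> ball x0 t)"
    using finite_branch_points_in_disc[OF x0 t(1,3,4)] by (rule finite_subset)
  then show ?thesis using that t(1) by blast
qed

end

section \<open>From quasiminimal sets to irreducible separators\<close>

text \<open>
  Quasiminimality makes \<open>K - F\<close> a null set, but this set is relatively open in \<open>K\<close>, and a coral set
  has no nonempty relatively open null subset.
\<close>

lemma quasiminimal_no_proper_competitor:
  assumes K: "quasiminimal_set M \<Omega> K" and "open \<Omega>"
    and x0: "x0 \<in> K" and r: "0 < r" "cball x0 r \<subseteq> \<Omega>"
    and F: "F \<subseteq> K" "topological_competitor \<Omega> K x0 r F"
  shows "F = K"
proof (rule ccontr)
  assume "F \<noteq> K"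
  then obtain y where y: "y \<in> K" "y \<notin> F" using F(1) by blast
  have coral: "closedin (top_of_set \<Omega>) K" "\<And>x e. x \<in> K \<Longrightarrow> e > 0 \<Longrightarrow> hausdorff_codim1 (K \<inter> ball x e) > 0"
    using K unfolding quasiminimal_set_def coral_set_def by auto
  have "closedin (top_of_set \<Omega>) F" using F(2) by (simp add: topological_competitor_def)
  then have "open (\<Omega> - F)" using \<open>open \<Omega>\<close> openin_open_eq openin_diff[OF openin_subtopology_self] by blast
  moreover have "y \<in> \<Omega> - F" using y closedin_imp_subset[OF coral(1)] by blast
  ultimately obtain e where e: "e > 0" "ball y e \<subseteq> \<Omega> - F" unfolding open_contains_ball by blast
  have "F - K = {}" using F(1) by blast
  moreover have "closure (ball x0 r) \<subseteq> \<Omega>" using r by simp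
  ultimately have "hausdorff_codim1 (K - F) \<le> ennreal M * hausdorff_codim1 ({} :: 'a set)"
    using K x0 r(1) F(2) unfolding quasiminimal_set_def by metis
  then have "hausdorff_codim1 (K - F) = 0" by (simp add: hausdorff_codim1_def hausdorff_measure_empty)
  moreover have "hausdorff_codim1 (K \<inter> ball y e) \<le> hausdorff_codim1 (K - F)"
    unfolding hausdorff_codim1_def by (rule hausdorff_measure_mono) (use e in blast)
  ultimately show False using coral(2)[OF y(1) e(1)] by simp
qed

lemma locally_finite_finite_circles:
  fixes K :: "'a::euclidean_space set"
  assumes dim: "DIM('a) = 2" and "open \<Omega>" and K: "hausdorff_locally_finite \<Omega> K"
    and x: "x \<in> \<Omega>" and "0 < \<rho>"
  shows "\<exists>t. 0 < t \<and> t < \<rho> \<and> cball x t \<subseteq> \<Omega> \<and> finite (K \<inter> sphere x t)"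
proof -
  obtain r where r: "r > 0" "hausdorff_codim1 (K \<inter> ball x r) < \<infinity>"
    using K x unfolding hausdorff_locally_finite_def by blast
  obtain e where e: "e > 0" "cball x e \<subseteq> \<Omega>" using \<open>open \<Omega>\<close> x open_contains_cball by blast
  have "hausdorff_measure 1 (K \<inter> ball x r) < \<infinity>" using r(2) dim by (simp add: hausdorff_codim1_def)
  moreover have "0 < min \<rho> (min r e)" using \<open>0 < \<rho>\<close> r e by simp
  ultimately obtain t where t: "0 < t" "t < min \<rho> (min r e)" "finite (K \<inter> ball x r \<inter> sphere x t)"
    by (rule exists_finite_sphere_slice)
  have "K \<inter> ball x r \<inter> sphere x t = K \<inter> sphere x t" using t(2) by auto
  moreover have "cball x t \<subseteq> \<Omega>" using e(2) t(2) by (force simp: subset_iff)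
  ultimately show ?thesis using t by auto
qed

section \<open>Transport along isometries\<close>

context
  fixes f :: "'a::euclidean_space \<Rightarrow> 'b::euclidean_space"
  assumes bij: "bij f" and isometry: "\<And>x y. dist (f x) (f y) = dist x y"
begin

lemma inj_isometry: "inj f"
  using bij by (rule bij_is_inj)

lemma isometry_homeomorphism: "homeomorphism S (f ` S) f (inv f)"
proof -
  have "continuous_on S f"
    unfolding continuous_on_iff using isometry by auto
  moreover have "continuous_on (f ` S) (inv f)"
    unfolding continuous_on_iff using isometry inj_isometry by auto
  ultimately show ?thesis
    using inj_isometry by (auto simp: homeomorphism_def image_image)
qed

lemma isometry_ball_image: "f ` ball x r = ball (f x) r"
  and isometry_cball_image: "f ` cball x r = cball (f x) r"
  and isometry_sphere_image: "f ` sphere x r = sphere (f x) r"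
proof -
  have "\<exists>z. y = f z" for y using bij by (metis bij_pointE)
  then show "f ` ball x r = ball (f x) r" "f ` cball x r = cball (f x) r" "f ` sphere x r = sphere (f x) r"
    by (force simp: isometry)+
qed

lemma connected_component_isometry_image:
  assumes "x \<in> S"
  shows "connected_component_set (f ` S) (f x) = f ` connected_component_set S x"
  by (rule connected_component_set_homeomorphism[OF isometry_homeomorphism assms])

lemma components_isometry_image: "components (f ` S) = (`) f ` components S"
  unfolding components_def by (auto simp: connected_component_isometry_image image_image)

lemma closedin_isometry_image_iff:
  "closedin (top_of_set (f ` S)) (f ` T) \<longleftrightarrow> closedin (top_of_set S) T"
proof
  assume T: "closedin (top_of_set (f ` S)) (f ` T)"
  then have "f ` T \<subseteq> f ` S" by (rule closedin_imp_subset)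
  then have sub: "T \<subseteq> S" using inj_isometry by (simp add: inj_image_subset_iff)
  have "closedin (top_of_set S) (S \<inter> f -` (f ` T))"
    using continuous_closedin_preimage_gen[OF _ _ T, of S f] isometry_homeomorphism[of S]
    by (auto simp: homeomorphism_def)
  moreover have "S \<inter> f -` (f ` T) = T" using sub inj_isometry by (simp add: inj_vimage_image_eq Int_absorb1)
  ultimately show "closedin (top_of_set S) T" by simp
next
  assume "closedin (top_of_set S) T"
  then show "closedin (top_of_set (f ` S)) (f ` T)"
    using homeomorphism_imp_closed_map[OF isometry_homeomorphism] by blast
qed

lemma topological_competitor_isometry_imageD:
  assumes "topological_competitor (f ` \<Omega>) (f ` K) (f x0) r (f ` F)"
  shows "topological_competitor \<Omega> K x0 r F"
  unfolding topological_competitor_def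
proof (intro conjI ballI impI)
  note img = image_set_diff[OF inj_isometry, symmetric] isometry_ball_image[symmetric]
  have comp: "closedin (top_of_set (f ` \<Omega>)) (f ` F)"
    "f ` F - ball (f x0) r = f ` K - ball (f x0) r"
    "\<And>u v. u \<in> f ` \<Omega> - (ball (f x0) r \<union> f ` K) \<Longrightarrow> v \<in> f ` \<Omega> - (ball (f x0) r \<union> f ` K) \<Longrightarrow>
      connected_component_set (f ` \<Omega> - f ` K) u \<noteq> connected_component_set (f ` \<Omega> - f ` K) v \<Longrightarrow>
      connected_component_set (f ` \<Omega> - f ` F) u \<noteq> connected_component_set (f ` \<Omega> - f ` F) v"
    using assms unfolding topological_competitor_def by blast+
  show "closedin (top_of_set \<Omega>) F" using comp(1) by (simp add: closedin_isometry_image_iff)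
  have "f ` (F - ball x0 r) = f ` (K - ball x0 r)" using comp(2) by (simp add: img)
  then show F: "F - ball x0 r = K - ball x0 r" using inj_isometry by (simp add: inj_image_eq_iff)
  fix u v assume u: "u \<in> \<Omega> - (ball x0 r \<union> K)" and v: "v \<in> \<Omega> - (ball x0 r \<union> K)"
    and ne: "connected_component_set (\<Omega> - K) u \<noteq> connected_component_set (\<Omega> - K) v"
  have in_K: "u \<in> \<Omega> - K" "v \<in> \<Omega> - K" using u v by auto
  have in_F: "u \<in> \<Omega> - F" "v \<in> \<Omega> - F" using u v F by blast+
  have mem: "f w \<in> f ` \<Omega> - (ball (f x0) r \<union> f ` K)" if "w \<in> \<Omega> - (ball x0 r \<union> K)" for w
    using that inj_isometry by (auto simp: isometry_ball_image[symmetric] inj_image_mem_iff)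
  have image: "connected_component_set (f ` \<Omega> - f ` A) (f w) = f ` connected_component_set (\<Omega> - A) w"
    if "w \<in> \<Omega> - A" for w A
    using connected_component_isometry_image[OF that] by (simp only: image_set_diff[OF inj_isometry])
  have "connected_component_set (f ` \<Omega> - f ` K) (f u) \<noteq> connected_component_set (f ` \<Omega> - f ` K) (f v)"
    using ne unfolding image[OF in_K(1)] image[OF in_K(2)] inj_image_eq_iff[OF inj_isometry] .
  then have "connected_component_set (f ` \<Omega> - f ` F) (f u) \<noteq> connected_component_set (f ` \<Omega> - f ` F) (f v)"
    using comp(3) mem u v by blast
  then show "connected_component_set (\<Omega> - F) u \<noteq> connected_component_set (\<Omega> - F) v"
    unfolding image[OF in_F(1)] image[OF in_F(2)] inj_image_eq_iff[OF inj_isometry] .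
qed

lemma interface_points_isometry_image:
  "interface_points (f ` \<Omega>) (f ` K) = f ` interface_points \<Omega> K"
proof -
  have card_eq: "card {C \<in> components (f ` \<Omega> - f ` K). C \<inter> (ball (f x) r - f ` K) \<noteq> {}}
      = card {C \<in> components (\<Omega> - K). C \<inter> (ball x r - K) \<noteq> {}}" for x r
  proof -
    have nonempty: "f ` C \<inter> (ball (f x) r - f ` K) \<noteq> {} \<longleftrightarrow> C \<inter> (ball x r - K) \<noteq> {}" for C
      by (simp only: isometry_ball_image[symmetric] image_set_diff[OF inj_isometry, symmetric]
          image_Int[OF inj_isometry, symmetric] image_is_empty)
    have comps: "components (f ` \<Omega> - f ` K) = (`) f ` components (\<Omega> - K)"
      by (simp only: image_set_diff[OF inj_isometry, symmetric] components_isometry_image)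
    have image_Collect: "{C \<in> (`) f ` X. P C} = (`) f ` {C \<in> X. P (f ` C)}" for X P by blast
    have "{C \<in> components (f ` \<Omega> - f ` K). C \<inter> (ball (f x) r - f ` K) \<noteq> {}}
        = (`) f ` {C \<in> components (\<Omega> - K). C \<inter> (ball x r - K) \<noteq> {}}"
      unfolding comps image_Collect nonempty ..
    moreover have "inj_on ((`) f) X" for X
      using inj_isometry by (auto simp: inj_on_def inj_image_eq_iff)
    ultimately show ?thesis by (simp add: card_image)
  qed
  have "ball (f x) r \<subseteq> f ` \<Omega> \<longleftrightarrow> ball x r \<subseteq> \<Omega>" for x r
    using inj_isometry by (simp add: isometry_ball_image[symmetric] inj_image_subset_iff)
  then have "(\<exists>r>0. ball (f x) r \<subseteq> f ` \<Omega> \<and>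
        card {C \<in> components (f ` \<Omega> - f ` K). C \<inter> (ball (f x) r - f ` K) \<noteq> {}} = 2)
      \<longleftrightarrow> (\<exists>r>0. ball x r \<subseteq> \<Omega> \<and> card {C \<in> components (\<Omega> - K). C \<inter> (ball x r - K) \<noteq> {}} = 2)" for x
    by (simp only: card_eq)
  then show ?thesis unfolding interface_points_def by blast
qed

end

definition complex_of_vec :: "real ^ 2 \<Rightarrow> complex" where
  "complex_of_vec v = Complex (v $ 1) (v $ 2)"

lemma bij_complex_of_vec: "bij complex_of_vec"
proof (rule bijI')
  show "complex_of_vec v = complex_of_vec w \<longleftrightarrow> v = w" for v w
    by (simp add: complex_of_vec_def vec_eq_iff forall_2)
  show "\<exists>v. z = complex_of_vec v" for z
    by (rule exI[of _ "vector [Re z, Im z]"]) (simp add: complex_of_vec_def)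
qed

lemma dist_complex_of_vec: "dist (complex_of_vec v) (complex_of_vec w) = dist v w"
  by (simp add: complex_of_vec_def dist_complex_def cmod_def dist_vec_def L2_set_def sum_2
      dist_real_def)

lemma quasiminimal_irreducible_separator:
  fixes \<Omega> K :: "(real^2) set"
  assumes "open \<Omega>" and K: "quasiminimal_set M \<Omega> K"
  shows "irreducible_separator (complex_of_vec ` \<Omega>) (complex_of_vec ` K)"
proof -
  let ?h = complex_of_vec
  note iso = bij_complex_of_vec dist_complex_of_vec
  note inj = bij_is_inj[OF bij_complex_of_vec]
  have closedin: "closedin (top_of_set \<Omega>) K" and lf: "hausdorff_locally_finite \<Omega> K"
    using K unfolding quasiminimal_set_def coral_set_def by auto
  have K\<Omega>: "K \<subseteq> \<Omega>" using closedin by (rule closedin_imp_subset)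
  have cball_iff: "cball (?h x) t \<subseteq> ?h ` \<Omega> \<longleftrightarrow> cball x t \<subseteq> \<Omega>" for x t
    unfolding isometry_cball_image[OF iso, symmetric] by (rule inj_image_subset_iff[OF inj])
  show ?thesis
  proof
    show "open (?h ` \<Omega>)"
      unfolding open_contains_ball
    proof
      fix y assume "y \<in> ?h ` \<Omega>"
      then obtain x where x: "x \<in> \<Omega>" "y = ?h x" by blast
      then obtain e where "e > 0" "ball x e \<subseteq> \<Omega>" using \<open>open \<Omega>\<close> open_contains_ball by blast
      then show "\<exists>e>0. ball y e \<subseteq> ?h ` \<Omega>"
        using x isometry_ball_image[OF iso, of x e] by (metis image_mono)
    qed
    show "closedin (top_of_set (?h ` \<Omega>)) (?h ` K)"
      using closedin by (simp add: closedin_isometry_image_iff[OF iso])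
    show "\<exists>t. 0 < t \<and> t < \<rho> \<and> cball y t \<subseteq> ?h ` \<Omega> \<and> finite (?h ` K \<inter> sphere y t)"
      if y: "y \<in> ?h ` K" and \<rho>: "0 < \<rho>" for y \<rho>
    proof -
      obtain x where x: "x \<in> K" "y = ?h x" using y by blast
      have "DIM(real ^ 2) = 2" by simp
      then obtain t where t: "0 < t" "t < \<rho>" "cball x t \<subseteq> \<Omega>" "finite (K \<inter> sphere x t)"
        using locally_finite_finite_circles[OF _ \<open>open \<Omega>\<close> lf _ \<rho>, of x] x K\<Omega> by blast
      have "?h ` K \<inter> sphere y t = ?h ` (K \<inter> sphere x t)"
        unfolding x(2) isometry_sphere_image[OF iso, symmetric] by (rule image_Int[OF inj, symmetric])
      then show ?thesis using t cball_iff x(2) by auto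
    qed
    show "F = ?h ` K"
      if comp: "y \<in> ?h ` K" "0 < r" "cball y r \<subseteq> ?h ` \<Omega>" "F \<subseteq> ?h ` K"
        "topological_competitor (?h ` \<Omega>) (?h ` K) y r F" for y r F
    proof -
      obtain x where x: "x \<in> K" "y = ?h x" using comp(1) by blast
      obtain F' where F': "F' \<subseteq> K" "F = ?h ` F'" using comp(4) by (auto elim: subset_imageE)
      have "topological_competitor \<Omega> K x r F'"
        using comp(5) topological_competitor_isometry_imageD[OF iso] unfolding x(2) F'(2) by blast
      moreover have "cball x r \<subseteq> \<Omega>" using comp(3) cball_iff x(2) by simp
      ultimately have "F' = K"
        using quasiminimal_no_proper_competitor[OF K \<open>open \<Omega>\<close> x(1) comp(2)] F'(1) by blast
      then show ?thesis using F'(2) by simp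
    qed
  qed
qed

theorem proposition7p1:
  fixes \<Omega> K :: "(real^2) set" and M :: real
  assumes "M \<ge> 1"
    and "open \<Omega>"
    and "quasiminimal_set M \<Omega> K"
  shows "(\<forall>x \<in> K - interface_points \<Omega> K. x isolated_in (K - interface_points \<Omega> K)) \<and>
         (\<forall>x \<in> \<Omega>. \<not> x islimpt (K - interface_points \<Omega> K))"
proof -
  let ?h = complex_of_vec and ?S = "K - interface_points \<Omega> K"
  note iso = bij_complex_of_vec dist_complex_of_vec
  note inj = bij_is_inj[OF bij_complex_of_vec]
  interpret irreducible_separator "?h ` \<Omega>" "?h ` K"
    using quasiminimal_irreducible_separator[OF assms(2,3)] .
  have closedin: "closedin (top_of_set \<Omega>) K"
    using assms(3) unfolding quasiminimal_set_def coral_set_def by auto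
  have no_limit: "\<not> x islimpt ?S" if x: "x \<in> \<Omega>" for x
  proof (cases "x \<in> K")
    case True
    then obtain t where t: "t > 0" "finite ((?h ` K - interface_points (?h ` \<Omega>) (?h ` K)) \<inter> ball (?h x) t)"
      using locally_finite_noninterface_points by blast
    have "(?h ` K - interface_points (?h ` \<Omega>) (?h ` K)) \<inter> ball (?h x) t = ?h ` (?S \<inter> ball x t)"
      by (simp add: interface_points_isometry_image[OF iso] isometry_ball_image[OF iso, symmetric]
          image_Int[OF inj] image_set_diff[OF inj])
    then have "finite (?S \<inter> ball x t)"
      using t(2) inj by (metis finite_imageD inj_on_subset subset_UNIV)
    then show ?thesis using t(1) by (auto simp: islimpt_eq_infinite_ball)
  next
    case False
    have "open (\<Omega> - K)"
      using assms(2) openin_open_eq openin_diff[OF openin_subtopology_self closedin] by blast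
    then have "\<exists>T. x \<in> T \<and> open T \<and> T \<inter> ?S = {}" using x False by blast
    then show ?thesis unfolding islimpt_def by blast
  qed
  moreover have "K \<subseteq> \<Omega>" using closedin by (rule closedin_imp_subset)
  ultimately show ?thesis by (auto simp: isolated_in_islimpt_iff)
qed

end
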